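(* Let $\mathcal{G}$ denote the family of graphs $G$ with at least $2$ vertices, with exactly $2|G|-2$ edges, and with no proper (not necessarily induced) subgraph of minimum degree $3$. Then, up to isomorphism, $\mathcal{G}$ consists exactly of all wheels $W_n$ ($n\ge 4$) together with those graphs that are formed, for some $i,j\geq 4$, from a copy of $H_i$ with connectors $x$ and $y$ and a vertex-disjoint copy of $H_j$ with connectors $x'$ and $y'$, either by identifying $x=x'$ and $y=y'$, or by identifying $x=y'$ and $y=x'$.
   Context: All graphs are finite and simple; $|G|$ is the number of vertices of $G$. A subgraph $H$ of $G$ is proper if $H\ne G$. "Minimum degree $3$" for a forbidden subgraph may be read as "minimum degree at least $3$". For $n\ge 4$, the wheel $W_n$ is the $n$-vertex graph with vertices $c, w_1,\dots,w_{n-1}$ and edges $cw_i$ and $w_iw_{i+1}$ for $i=1,\dots,n-1$, where the indices of the $w$'s are taken modulo $n-1$. For $n\geq 4$, $H_n$ is the graph on the $n$ vertices $x$, $y$, $v_1,\dots,v_{n-2}$ with edges $v_iv_{i+1}$ for $1\le i\le n-3$, $xv_i$ for $1\le i\le n-2$, $yv_1$, and $yv_{n-2}$. The vertices $x$ and $y$ are called the connectors of $H_n$; their roles are not symmetric: $y$ always denotes the one of degree two adjacent only to $v_1$ and $v_{n-2}$, and $x$ the one adjacent to all $v_i$ (similarly for $x',y'$ in the second copy). *)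

theory Defs
  imports Main
begin

datatype 'a graph = Graph (verts: "'a set") (edges: "'a set set")

definition simple_graph :: "'a graph \<Rightarrow> bool" where
  "simple_graph G \<longleftrightarrow> finite (verts G) \<and> (\<forall>e \<in> edges G. e \<subseteq> verts G \<and> card e = 2)"

definition subgraph :: "'a graph \<Rightarrow> 'a graph \<Rightarrow> bool" where
  "subgraph H G \<longleftrightarrow> simple_graph H \<and> verts H \<subseteq> verts G \<and> edges H \<subseteq> edges G"

definition degree :: "'a graph \<Rightarrow> 'a \<Rightarrow> nat" where
  "degree G v = card {e \<in> edges G. v \<in> e}"

text \<open>Unspecified for the graph without vertices.\<close>
definition min_degree :: "'a graph \<Rightarrow> nat" where
  "min_degree G = Min (degree G ` verts G)"

definition map_graph :: "('a \<Rightarrow> 'b) \<Rightarrow> 'a graph \<Rightarrow> 'b graph" where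
  "map_graph f G = Graph (f ` verts G) ((`) f ` edges G)"

definition isomorphic :: "'a graph \<Rightarrow> 'b graph \<Rightarrow> bool" where
  "isomorphic G H \<longleftrightarrow> (\<exists>f. inj_on f (verts G) \<and> map_graph f G = H)"

definition extremal_family :: "'a graph set" where
  "extremal_family = {G. simple_graph G \<and> card (verts G) \<ge> 2 \<and>
     card (edges G) = 2 * card (verts G) - 2 \<and>
     \<not> (\<exists>H. subgraph H G \<and> H \<noteq> G \<and> verts H \<noteq> {} \<and> min_degree H \<ge> 3)}"

datatype wheel_vertex = Hub | Rim nat

text \<open>The successor of the index \<open>i\<close> on the cyclically ordered set \<open>{1..n-1}\<close> is
  \<open>i mod (n - 1) + 1\<close>.\<close>
definition wheel :: "nat \<Rightarrow> wheel_vertex graph" where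
  "wheel n = Graph (insert Hub (Rim ` {1..n-1}))
     ((\<lambda>i. {Hub, Rim i}) ` {1..n-1} \<union> (\<lambda>i. {Rim i, Rim (i mod (n-1) + 1)}) ` {1..n-1})"

datatype H_vertex = ConnX | ConnY | PathV nat

definition H_graph :: "nat \<Rightarrow> H_vertex graph" where
  "H_graph n = Graph ({ConnX, ConnY} \<union> PathV ` {1..n-2})
     ((\<lambda>i. {PathV i, PathV (i+1)}) ` {1..n-3} \<union> (\<lambda>i. {ConnX, PathV i}) ` {1..n-2} \<union>
      {{ConnY, PathV 1}, {ConnY, PathV (n-2)}})"

definition disjoint_union :: "'a graph \<Rightarrow> 'b graph \<Rightarrow> ('a + 'b) graph" where
  "disjoint_union G H = Graph (verts G <+> verts H)
     ((`) Inl ` edges G \<union> (`) Inr ` edges H)"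

text \<open>Parallel edges arising from the identification would be merged, and a loop would become a
  singleton edge. Neither happens below: the identified vertices lie in different copies, and as
  \<open>ConnX\<close> and \<open>ConnY\<close> are not adjacent in \<open>H_graph n\<close>, they have no common neighbour.\<close>
definition identify :: "'a \<Rightarrow> 'a \<Rightarrow> 'a graph \<Rightarrow> 'a graph" where
  "identify u v G = map_graph (id(v := u)) G"

definition glue_straight :: "nat \<Rightarrow> nat \<Rightarrow> (H_vertex + H_vertex) graph" where
  "glue_straight i j =
     identify (Inl ConnY) (Inr ConnY) (identify (Inl ConnX) (Inr ConnX) (disjoint_union (H_graph i) (H_graph j)))"

definition glue_crossed :: "nat \<Rightarrow> nat \<Rightarrow> (H_vertex + H_vertex) graph" where
  "glue_crossed i j =
     identify (Inl ConnY) (Inr ConnX) (identify (Inl ConnX) (Inr ConnY) (disjoint_union (H_graph i) (H_graph j)))"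

end

(* Let A be the set of vertices of degree 3 and B the rest. Deleting an edge shows that B is
   independent. Repeated deletion of vertices of degree at most 2 shows that a proper set S of at
   least two vertices spans at most 2|S| - 3 edges; call S tight in case of equality. A tight set
   stays tight when a vertex of degree at most 2 is deleted, and that degree is then exactly 2.

   If |B| <= 1, degree counting gives a vertex joined to all others, and the rest is a cycle.
   Otherwise, deleting vertices one at a time leads to closed tight sets (those containing all
   neighbours of their members from A) that meet B in any prescribed number of vertices. One that
   meets B in just two vertices is a copy of H_n with these as connectors. If |B| = 2, then the
   complement of its A-part is again closed and tight, so G is glued from two such copies.

   Suppose |B| >= 3. Take closed tight U within T - {z} with B-parts {x, y} and {x, y, z}, where z
   has two neighbours u, w in T, both in K = T - U - {z}. Deleting u, and then within K whatever
   drops below degree 3, spares w and leaves x and y a neighbour in the rest of K, for otherwise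
   some proper set would span too many edges. So a proper subgraph of minimum degree 3 remains.

   Conversely, in a subgraph of minimum degree 3 a vertex whose degree in G is 3 keeps all its
   edges, so such a subgraph spreads along the rim of a wheel or along the path of a copy of H_n;
   it cannot stop at one of two glued copies, since y has degree 2 there. *)

theory Submission
  imports Defs
begin

section \<open>Edge counting in simple graphs\<close>

locale sgraph =
  fixes G :: "'a graph"
  assumes simple: "simple_graph G"
begin

abbreviation V where "V \<equiv> verts G"
abbreviation E where "E \<equiv> edges G"

definition nbrs :: "'a set \<Rightarrow> 'a \<Rightarrow> 'a set" where
  "nbrs S v = {w \<in> S. {v, w} \<in> E}"

definition deg_in :: "'a set \<Rightarrow> 'a \<Rightarrow> nat" where
  "deg_in S v = card (nbrs S v)"

definition edges_in :: "'a set \<Rightarrow> 'a set set" where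
  "edges_in S = {e \<in> E. e \<subseteq> S}"

definition esize :: "'a set \<Rightarrow> nat" where
  "esize S = card (edges_in S)"

lemma finite_V: "finite V"
  using simple by (simp add: simple_graph_def)

lemma finite_E: "finite E"
proof -
  have "E \<subseteq> Pow V" using simple by (auto simp: simple_graph_def)
  then show ?thesis using finite_V by (meson finite_Pow_iff finite_subset)
qed

lemma finite_sub: "S \<subseteq> V \<Longrightarrow> finite S"
  using finite_V finite_subset by blast

lemma edge_in_V: "{v, w} \<in> E \<Longrightarrow> v \<in> V \<and> w \<in> V"
  using simple by (auto simp: simple_graph_def)

lemma edge_neq: "{v, w} \<in> E \<Longrightarrow> v \<noteq> w"
  using simple by (auto simp: simple_graph_def)

lemma edge_exE:
  assumes "e \<in> E" obtains v w where "e = {v, w}" "v \<noteq> w"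
  using assms simple by (metis simple_graph_def card_2_iff)

lemma edge_through:
  assumes "e \<in> E" "v \<in> e" obtains w where "e = {v, w}" "v \<noteq> w"
  using assms by (metis edge_exE insert_commute insertE singletonD)

lemma nbrs_sub: "nbrs S v \<subseteq> S - {v}"
  using edge_neq by (auto simp: nbrs_def)

lemma nbrs_mono: "S \<subseteq> T \<Longrightarrow> nbrs S v \<subseteq> nbrs T v"
  by (auto simp: nbrs_def)

lemma finite_nbrs: "S \<subseteq> V \<Longrightarrow> finite (nbrs S v)"
  by (rule finite_sub) (auto simp: nbrs_def)

lemma finite_nbrs': "finite S \<Longrightarrow> finite (nbrs S v)"
  by (auto simp: nbrs_def)

lemma deg_in_mono: "S \<subseteq> T \<Longrightarrow> finite T \<Longrightarrow> deg_in S v \<le> deg_in T v"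
  unfolding deg_in_def by (meson card_mono finite_nbrs' nbrs_mono)

lemma deg_in_le: "finite S \<Longrightarrow> v \<in> S \<Longrightarrow> deg_in S v \<le> card S - 1"
  unfolding deg_in_def
  by (metis card_Diff_singleton card_mono finite_Diff nbrs_sub)

lemma finite_edges_in: "finite (edges_in S)"
  using finite_E by (auto simp: edges_in_def)

lemma card_star:
  "card {e \<in> edges_in S. v \<in> e} = deg_in S v" if "v \<in> S"
proof -
  have "bij_betw (\<lambda>w. {v, w}) (nbrs S v) {e \<in> edges_in S. v \<in> e}"
  proof (rule bij_betw_imageI)
    show "inj_on (\<lambda>w. {v, w}) (nbrs S v)" by (auto simp: inj_on_def doubleton_eq_iff)
    show "(\<lambda>w. {v, w}) ` nbrs S v = {e \<in> edges_in S. v \<in> e}"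
    proof
      show "(\<lambda>w. {v, w}) ` nbrs S v \<subseteq> {e \<in> edges_in S. v \<in> e}"
        using that unfolding nbrs_def edges_in_def by blast
      show "{e \<in> edges_in S. v \<in> e} \<subseteq> (\<lambda>w. {v, w}) ` nbrs S v"
      proof
        fix e assume e: "e \<in> {e \<in> edges_in S. v \<in> e}"
        then have "e \<in> E" "v \<in> e" "e \<subseteq> S" by (simp_all add: edges_in_def)
        then obtain w where "e = {v, w}" by (meson edge_through)
        then show "e \<in> (\<lambda>w. {v, w}) ` nbrs S v"
          using \<open>e \<in> E\<close> \<open>e \<subseteq> S\<close> by (intro image_eqI[of _ _ w]) (simp_all add: nbrs_def)
      qed
    qed
  qed
  then show ?thesis by (simp add: deg_in_def bij_betw_same_card)
qed

lemma esize_remove: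
  assumes "v \<in> S"
  shows "esize S = esize (S - {v}) + deg_in S v"
proof -
  have "edges_in S = edges_in (S - {v}) \<union> {e \<in> edges_in S. v \<in> e}"
    by (auto simp: edges_in_def)
  moreover have "edges_in (S - {v}) \<inter> {e \<in> edges_in S. v \<in> e} = {}"
    by (auto simp: edges_in_def)
  ultimately show ?thesis
    by (metis (lifting) card_Un_disjoint card_star assms esize_def finite_Un finite_edges_in)
qed

lemma edges_in_V: "edges_in V = E"
proof -
  have "\<And>e. e \<in> E \<Longrightarrow> e \<subseteq> V" using simple by (simp add: simple_graph_def)
  then show ?thesis unfolding edges_in_def by blast
qed

lemma deg_in_V: "v \<in> V \<Longrightarrow> degree G v = deg_in V v"
  using card_star[of v V] by (simp add: degree_def edges_in_V)

lemma esize_V: "esize V = card E"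
  by (simp add: esize_def edges_in_V)

lemma esize_single: "esize {v} = 0"
proof -
  have "edges_in {v} = {}"
    unfolding edges_in_def using simple by (auto simp: simple_graph_def subset_singleton_iff)
  then show ?thesis by (simp add: esize_def)
qed

lemma esize_pair_le: "esize {v, w} \<le> 1"
proof (cases "v = w")
  case False
  have "nbrs {v, w} v \<subseteq> {w}" using nbrs_sub[of "{v, w}" v] by auto
  then have "deg_in {v, w} v \<le> 1" unfolding deg_in_def using card_mono[of "{w}" "nbrs {v, w} v"] by simp
  then show ?thesis using esize_remove[of v "{v, w}"] esize_single[of w] False by simp
qed (simp add: esize_single)

lemma deg_in_insert:
  assumes "finite S" "v \<notin> S" "w \<noteq> v"
  shows "deg_in (insert v S) w = deg_in S w + (if v \<in> nbrs V w then 1 else 0)"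
proof -
  have "nbrs (insert v S) w = nbrs S w \<union> (if v \<in> nbrs V w then {v} else {})"
    using edge_in_V by (auto simp: nbrs_def)
  moreover have "v \<notin> nbrs S w" using assms by (auto simp: nbrs_def)
  ultimately show ?thesis using finite_nbrs'[OF assms(1), of w] by (simp add: deg_in_def)
qed

text \<open>Induction on S: a new vertex v contributes \<open>deg_in S v\<close> of its own and
  raises the degree of each of its neighbours in S by 1, which is twice the number of new
  edges.\<close>

lemma handshake:
  assumes "finite S" "S \<subseteq> V"
  shows "(\<Sum>v\<in>S. deg_in S v) = 2 * esize S"
  using assms
proof (induction S rule: finite_induct)
  case empty
  have "edges_in {} = {}" using simple by (auto simp: edges_in_def simple_graph_def)
  then show ?case by (simp add: esize_def)
next
  case (insert v S)
  have "nbrs (insert v S) v = nbrs S v" using nbrs_sub[of "insert v S" v] by (auto simp: nbrs_def)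
  then have dv: "deg_in (insert v S) v = deg_in S v" by (simp add: deg_in_def)
  have "(\<Sum>w\<in>S. deg_in (insert v S) w) = (\<Sum>w\<in>S. deg_in S w + (if v \<in> nbrs V w then 1 else 0))"
    using insert.hyps by (intro sum.cong refl deg_in_insert) auto
  also have "\<dots> = 2 * esize S + card {w \<in> S. v \<in> nbrs V w}"
    using insert.IH insert.prems insert.hyps(1) by (simp add: sum.distrib sum.If_cases Collect_conj_eq)
  also have "{w \<in> S. v \<in> nbrs V w} = nbrs S v"
    using insert.prems by (auto simp: nbrs_def insert_commute)
  finally have "(\<Sum>w\<in>S. deg_in (insert v S) w) = 2 * esize S + deg_in S v"
    by (simp add: deg_in_def)
  moreover have "esize (insert v S) = esize S + deg_in S v"
    using esize_remove[of v "insert v S"] insert dv by simp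
  ultimately show ?case using insert dv by simp
qed

lemma edges_in_Un:
  assumes "\<And>v w. v \<in> S - T \<Longrightarrow> w \<in> T - S \<Longrightarrow> {v, w} \<notin> E"
  shows "edges_in (S \<union> T) = edges_in S \<union> edges_in T"
proof
  show "edges_in (S \<union> T) \<subseteq> edges_in S \<union> edges_in T"
  proof
    fix e assume e: "e \<in> edges_in (S \<union> T)"
    then obtain v w where vw: "e = {v, w}" unfolding edges_in_def by (blast elim: edge_exE)
    then show "e \<in> edges_in S \<union> edges_in T"
      using e assms[of v w] assms[of w v] by (auto simp: edges_in_def insert_commute)
  qed
qed (auto simp: edges_in_def)

text \<open>With no edge between the two differences, every edge inside the union lies inside S or
  inside T, and inside both exactly if it lies inside the intersection.\<close>

lemma esize_Un:
  assumes "\<And>v w. v \<in> S - T \<Longrightarrow> w \<in> T - S \<Longrightarrow> {v, w} \<notin> E"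
  shows "esize (S \<union> T) + esize (S \<inter> T) = esize S + esize T"
proof -
  have "edges_in (S \<inter> T) = edges_in S \<inter> edges_in T"
    by (auto simp: edges_in_def)
  then show ?thesis
    using card_Un_Int[OF finite_edges_in finite_edges_in, of S T] edges_in_Un[OF assms]
    by (simp add: esize_def)
qed

text \<open>Deleting a vertex of degree at most 2 preserves
  \<open>2 * card S \<le> esize S + 2\<close>. The deletions stop before only two vertices are left,
  since these would have to span two edges; where they stop, all degrees are at least 3.\<close>

lemma exists_core:
  assumes "S \<subseteq> V" "2 \<le> card S" "2 * card S \<le> esize S + 2"
  shows "\<exists>T\<subseteq>S. T \<noteq> {} \<and> (\<forall>v\<in>T. 3 \<le> deg_in T v)"
  using assms
proof (induction "card S" arbitrary: S rule: less_induct)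
  case less
  have fin: "finite S" using less.prems finite_sub by blast
  show ?case
  proof (cases "\<forall>v\<in>S. 3 \<le> deg_in S v")
    case True
    then show ?thesis using less.prems by (metis card.empty not_numeral_le_zero order_refl)
  next
    case False
    then obtain v where v: "v \<in> S" "deg_in S v \<le> 2" by force
    have c: "card (S - {v}) = card S - 1" using v fin by simp
    have "card S \<noteq> 2"
    proof
      assume "card S = 2"
      then obtain a b where "S = {a, b}" by (meson card_2_iff)
      then show False using esize_pair_le[of a b] less.prems(3) \<open>card S = 2\<close> by simp
    qed
    then have "2 \<le> card (S - {v})" using c less.prems by linarith
    moreover have "2 * card (S - {v}) \<le> esize (S - {v}) + 2"
      using esize_remove[OF v(1)] v(2) less.prems c by linarith
    moreover have "card (S - {v}) < card S" "S - {v} \<subseteq> V"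
      using fin v(1) less.prems(1) by (auto intro: card_Diff1_less simp del: card_Diff_insert card_Diff_singleton)
    ultimately obtain T where "T \<subseteq> S - {v}" "T \<noteq> {}" "\<forall>v\<in>T. 3 \<le> deg_in T v"
      using less.hyps[of "S - {v}"] by meson
    then show ?thesis by blast
  qed
qed

end

section \<open>Recognizing the graph H\<close>

text \<open>The last hypothesis rules out further components, which would be cycles.\<close>
lemma path_enumeration:
  fixes R :: "'a \<Rightarrow> 'a \<Rightarrow> bool"
  assumes fin: "finite L"
    and sym: "\<And>a b. R a b \<Longrightarrow> R b a" and irr: "\<And>a. \<not> R a a"
    and uw: "u \<in> L" "w \<in> L" "u \<noteq> w"
    and deg: "\<And>v. v \<in> L \<Longrightarrow> card {t \<in> L. R v t} = (if v \<in> {u, w} then 1 else 2)"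
    and sparse: "\<And>D. D \<subseteq> L \<Longrightarrow> D \<noteq> {} \<Longrightarrow> \<exists>v\<in>D. card {t \<in> D. R v t} \<le> 1"
  obtains p m where "2 \<le> m" "bij_betw p {1..m} L" "p 1 = u" "p m = w"
    "\<And>i. i \<in> {1..<m} \<Longrightarrow> R (p i) (p (Suc i))"
    "\<And>i j. i \<in> {1..m} \<Longrightarrow> j \<in> {1..m} \<Longrightarrow> R (p i) (p j) \<Longrightarrow> j = Suc i \<or> i = Suc j"
proof -
  define N where "N v = {t \<in> L. R v t}" for v
  have finN: "finite (N v)" for v using fin by (simp add: N_def)
  \<comment> \<open>Paths in L that start at u and have m vertices. Injectivity gives
    \<open>m \<le> card L\<close>, so a longest one exists.\<close>
  define walk where "walk p m \<longleftrightarrow> 1 \<le> m \<and> inj_on p {1..m} \<and> p ` {1..m} \<subseteq> L \<and> p 1 = u \<and>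
    (\<forall>i\<in>{1..<m}. R (p i) (p (Suc i)))" for p and m :: nat
  have "walk (\<lambda>_. u) 1" using uw by (simp add: walk_def)
  moreover have "m \<le> card L" if "walk p m" for p m
    using that card_inj_on_le[of p "{1..m}" L] fin by (simp add: walk_def)
  ultimately have "\<exists>m. (\<exists>p. walk p m) \<and> (\<forall>k. (\<exists>p. walk p k) \<longrightarrow> k \<le> m)"
    by (intro ex_has_greatest_nat[of "\<lambda>m. \<exists>p. walk p m" 1 "\<lambda>m. m" "Suc (card L)"]) (auto simp: less_Suc_eq_le)
  then obtain m where ex: "\<exists>p. walk p m" and maxm: "\<And>p k. walk p k \<Longrightarrow> k \<le> m"
    by metis
  then obtain p where p: "walk p m" by blast
  have inj: "inj_on p {1..m}" and sub: "p ` {1..m} \<subseteq> L" and p1: "p 1 = u" and m1: "1 \<le> m"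
    and step: "\<And>i. i \<in> {1..<m} \<Longrightarrow> R (p i) (p (Suc i))"
    using p by (auto simp: walk_def)
  have inL: "p i \<in> L" if "i \<in> {1..m}" for i using sub that by auto
  \<comment> \<open>A neighbour t off the path could be appended as \<open>p (Suc m)\<close>,
    against the maximality of m.\<close>
  have ext: "t \<in> p ` {1..m}" if "t \<in> N (p m)" for t
  proof (rule ccontr)
    assume t: "t \<notin> p ` {1..m}"
    define q where "q = p(Suc m := t)"
    have q: "q i = p i" if "i \<le> m" for i using that by (simp add: q_def)
    have ins: "{1..Suc m} = insert (Suc m) {1..m}" by auto
    have qi: "q ` {1..m} = p ` {1..m}" using q by (intro image_cong) auto
    have "inj_on q {1..m}" using inj inj_on_cong[of "{1..m}" q p] q by simp
    moreover have "q (Suc m) \<notin> q ` {1..m}" using t qi by (simp add: q_def)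
    ultimately have "inj_on q {1..Suc m}" unfolding ins by (simp add: inj_on_insert)
    moreover have "q ` {1..Suc m} \<subseteq> L"
      unfolding ins using sub that qi by (auto simp: N_def q_def)
    moreover have "R (q i) (q (Suc i))" if "i \<in> {1..<Suc m}" for i
    proof (cases "i = m")
      case True
      then show ?thesis using \<open>t \<in> N (p m)\<close> by (simp add: q_def N_def)
    next
      case False
      then show ?thesis using that step[of i] q by simp
    qed
    moreover have "q 1 = u" using p1 m1 q by simp
    ultimately have "walk q (Suc m)" by (simp add: walk_def)
    then show False using maxm by fastforce
  qed
  have m2: "2 \<le> m"
  proof (rule ccontr)
    assume "\<not> 2 \<le> m"
    then have "m = 1" using m1 by simp
    have "card (N u) = 1" using deg[OF uw(1)] by (simp add: N_def)
    then obtain t where "t \<in> N u" by (metis card_1_singletonE insertI1)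
    then have "t \<in> p ` {1..1}" using ext \<open>m = 1\<close> p1 by simp
    then show False using \<open>t \<in> N u\<close> p1 irr by (simp add: N_def)
  qed
  have prev: "p (i - 1) \<in> N (p i)" if "i \<in> {2..m}" for i
  proof -
    have "i - 1 \<in> {1..<m}" "Suc (i - 1) = i" using that by auto
    then show ?thesis using step[of "i - 1"] inL[of "i - 1"] sym by (simp add: N_def)
  qed
  have succ: "p (Suc i) \<in> N (p i)" if "i \<in> {1..<m}" for i
    using step[of i] that inL[of "Suc i"] by (simp add: N_def)
  have Nu: "N (p 1) = {p 2}"
  proof -
    have "card (N (p 1)) = 1" using deg[OF uw(1)] p1 by (simp add: N_def)
    moreover have "p 2 \<in> N (p 1)" using succ[of 1] m2 by (simp add: numeral_2_eq_2)
    ultimately show ?thesis by (metis card_1_singletonE singletonD)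
  qed
  \<comment> \<open>An inner vertex has at most two neighbours in L, and those next to it on the
    path use them up.\<close>
  have Nmid: "N (p i) = {p (i - 1), p (Suc i)}" if "i \<in> {2..<m}" for i
  proof -
    have ne: "p (i - 1) \<noteq> p (Suc i)"
    proof -
      have "i - 1 \<in> {1..m}" "Suc i \<in> {1..m}" "i - 1 \<noteq> Suc i" using that by auto
      then show ?thesis using inj by (meson inj_onD)
    qed
    have s: "{p (i - 1), p (Suc i)} \<subseteq> N (p i)" using prev[of i] succ[of i] that by auto
    have "card (N (p i)) \<le> 2" using deg[OF inL[of i]] that by (simp add: N_def)
    moreover have "card {p (i - 1), p (Suc i)} = 2" using ne by simp
    ultimately show ?thesis using s finN by (metis card_seteq)
  qed
  \<comment> \<open>If the path ended elsewhere, its last vertex would have a second neighbour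
    \<open>p i\<close> on the path with i < m - 1. But by \<open>Nu\<close> and \<open>Nmid\<close>
    all neighbours of \<open>p i\<close> are next to it on the path.\<close>
  have pm: "p m = w"
  proof (rule ccontr)
    assume "p m \<noteq> w"
    moreover have "p m \<noteq> u" using inj_onD[OF inj, of m 1] p1 m2 by auto
    ultimately have "card (N (p m)) = 2" using deg[OF inL[of m]] m1 by (simp add: N_def)
    moreover have "p (m - 1) \<in> N (p m)" using prev[of m] m2 by simp
    ultimately obtain t where t: "t \<in> N (p m)" "t \<noteq> p (m - 1)"
      by (metis card_2_iff doubleton_eq_iff insertCI)
    then obtain i where i: "i \<in> {1..m}" "t = p i" using ext by blast
    have "i \<noteq> m" using t(1) i irr by (auto simp: N_def)
    moreover have "i \<noteq> m - 1" using t(2) i by auto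
    ultimately have im: "i < m - 1" using i by auto
    have pmi: "p m \<in> N (p i)" using t(1) i sym inL[of m] m1 by (simp add: N_def)
    show False
    proof (cases "i = 1")
      case True
      then have "p m = p 2" using pmi Nu by simp
      then show False using inj_onD[OF inj, of m 2] m2 im True by auto
    next
      case False
      then have mem: "i \<in> {2..<m}" "i - 1 \<in> {1..m}" "Suc i \<in> {1..m}" "m \<in> {1..m}"
        using i im by auto
      then have "p m = p (i - 1) \<or> p m = p (Suc i)" using pmi Nmid[OF mem(1)] by simp
      then have "m = i - 1 \<or> m = Suc i" using inj mem by (meson inj_onD)
      then show False using im by auto
    qed
  qed
  have Nm: "N (p m) = {p (m - 1)}"
  proof -
    have "card (N (p m)) = 1" using deg[OF uw(2)] pm by (simp add: N_def)
    moreover have "p (m - 1) \<in> N (p m)" using prev[of m] m2 by simp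
    ultimately show ?thesis by (metis card_1_singletonE singletonD)
  qed
  have nb: "j = Suc i \<or> i = Suc j" if "i \<in> {1..m}" "j \<in> {1..m}" "R (p i) (p j)" for i j
  proof -
    have pj: "p j \<in> N (p i)" using that inL by (simp add: N_def)
    have "i = 1 \<or> i = m \<or> i \<in> {2..<m}" using that(1) by auto
    then consider "i = 1" | "i = m" | "i \<in> {2..<m}" by blast
    then show ?thesis
    proof cases
      case 1
      then show ?thesis using pj Nu inj_onD[OF inj, of j 2] that m2 by auto
    next
      case 2
      then have "p j = p (m - 1)" "m - 1 \<in> {1..m}" using pj Nm m2 by auto
      then have "j = m - 1" using inj that(2) by (meson inj_onD)
      then show ?thesis using 2 m2 by simp
    next
      case 3
      then have "p j = p (i - 1) \<or> p j = p (Suc i)" using pj Nmid[of i] by simp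
      moreover have "i - 1 \<in> {1..m}" "Suc i \<in> {1..m}" using 3 by auto
      ultimately have "j = i - 1 \<or> j = Suc i" using inj that(2) by (meson inj_onD)
      then show ?thesis using 3 by auto
    qed
  qed
  have Nrange: "N (p i) \<subseteq> p ` {1..m}" if "i \<in> {1..m}" for i
  proof -
    have "i = 1 \<or> i = m \<or> i \<in> {2..<m}" using that by auto
    then consider "i = 1" | "i = m" | "i \<in> {2..<m}" by blast
    then show ?thesis
    proof cases
      case 3
      then have "i - 1 \<in> {1..m}" "Suc i \<in> {1..m}" by auto
      then show ?thesis unfolding Nmid[OF 3] by blast
    qed (use Nu Nm m2 in auto)
  qed
  \<comment> \<open>Vertices off the path have no neighbour on it and differ from u and w, so each
    keeps its two neighbours off the path. This contradicts \<open>sparse\<close>.\<close>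
  have "p ` {1..m} = L"
  proof (rule ccontr)
    assume "p ` {1..m} \<noteq> L"
    then have "L - p ` {1..m} \<noteq> {}" using sub by auto
    then obtain v where v: "v \<in> L" "v \<notin> p ` {1..m}"
      and c: "card {t \<in> L - p ` {1..m}. R v t} \<le> 1"
      using sparse[of "L - p ` {1..m}"] by auto
    have "u \<in> p ` {1..m}" "w \<in> p ` {1..m}" using p1 pm m1 by force+
    then have "card {t \<in> L. R v t} = 2" using deg[OF v(1)] v(2) by auto
    moreover have "\<not> R v (p i)" if "i \<in> {1..m}" for i
    proof
      assume "R v (p i)"
      then have "v \<in> N (p i)" using v(1) sym by (simp add: N_def)
      then show False using Nrange[OF that] v(2) by blast
    qed
    then have "{t \<in> L - p ` {1..m}. R v t} = {t \<in> L. R v t}" by blast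
    ultimately show False using c by simp
  qed
  then have "bij_betw p {1..m} L" using inj by (simp add: bij_betw_def)
  then show ?thesis using that[OF m2 _ p1 pm] step nb by blast
qed

lemma edges_H_graph: "edges (H_graph n) = (\<lambda>i. {PathV i, PathV (i+1)}) ` {1..n-3} \<union>
  (\<lambda>i. {ConnX, PathV i}) ` {1..n-2} \<union> {{ConnY, PathV 1}, {ConnY, PathV (n-2)}}"
  by (simp add: H_graph_def)

lemma verts_H_graph: "verts (H_graph n) = {ConnX, ConnY} \<union> PathV ` {1..n-2}"
  by (simp add: H_graph_def)

text \<open>The wheel on \<open>n\<close> vertices arises from \<open>H_graph n\<close> by joining the two connectors.\<close>
definition wheel_embedding :: "(H_vertex \<Rightarrow> 'a) \<Rightarrow> nat \<Rightarrow> 'a graph \<Rightarrow> bool" where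
  "wheel_embedding \<phi> n G \<longleftrightarrow> 4 \<le> n \<and> inj_on \<phi> (verts (H_graph n)) \<and>
     verts G = \<phi> ` verts (H_graph n) \<and>
     edges G = insert {\<phi> ConnX, \<phi> ConnY} ((`) \<phi> ` edges (H_graph n))"

text \<open>The connector pairs are matched as sets, not as ordered pairs, so one predicate covers
  both ways of identifying them.\<close>

definition glued :: "(H_vertex \<Rightarrow> 'a) \<Rightarrow> (H_vertex \<Rightarrow> 'a) \<Rightarrow> nat \<Rightarrow> nat \<Rightarrow> 'a graph \<Rightarrow> bool" where
  "glued \<phi> \<psi> i j G \<longleftrightarrow> 4 \<le> i \<and> 4 \<le> j \<and>
     inj_on \<phi> (verts (H_graph i)) \<and> inj_on \<psi> (verts (H_graph j)) \<and>
     \<phi> ` {ConnX, ConnY} = \<psi> ` {ConnX, ConnY} \<and>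
     \<phi> ` verts (H_graph i) \<inter> \<psi> ` verts (H_graph j) = \<phi> ` {ConnX, ConnY} \<and>
     verts G = \<phi> ` verts (H_graph i) \<union> \<psi> ` verts (H_graph j) \<and>
     edges G = (`) \<phi> ` edges (H_graph i) \<union> (`) \<psi> ` edges (H_graph j)"

context sgraph
begin

text \<open>Put L = S - {x, y}. A vertex of L has degree 3 in S and spends one edge on x; only the
  two neighbours of y spend another one on y. So inside L the degrees are 2 except for two that are
  1, and L is a path. A possible edge between x and y is left out of \<open>degy\<close> and of the
  conclusion: it is present in a wheel and absent in a glued copy.\<close>

lemma H_graph_structure:
  assumes SV: "S \<subseteq> V" and xy: "x \<in> S" "y \<in> S" "x \<noteq> y"
    and hub: "\<And>v. v \<in> S - {x, y} \<Longrightarrow> {x, v} \<in> E"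
    and deg3: "\<And>v. v \<in> S - {x, y} \<Longrightarrow> deg_in S v = 3"
    and degy: "deg_in (S - {x}) y = 2"
    and sparse: "\<And>D. D \<subseteq> S - {x, y} \<Longrightarrow> D \<noteq> {} \<Longrightarrow> \<exists>v\<in>D. deg_in D v \<le> 1"
  obtains \<phi> n where "4 \<le> n" "inj_on \<phi> (verts (H_graph n))" "\<phi> ConnX = x" "\<phi> ConnY = y"
    "\<phi> ` verts (H_graph n) = S" "edges_in S - {{x, y}} = (`) \<phi> ` edges (H_graph n)"
proof -
  define L where "L = S - {x, y}"
  have finL: "finite L" using SV finite_sub by (auto simp: L_def)
  obtain u w where uw: "nbrs (S - {x}) y = {u, w}" "u \<noteq> w"
    using degy unfolding deg_in_def by (meson card_2_iff)
  then have uL: "u \<in> L" and wL: "w \<in> L" using nbrs_sub[of "S - {x}" y] by (auto simp: L_def)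
  have degL: "card {t \<in> L. {v, t} \<in> E} = (if v \<in> {u, w} then 1 else 2)" if "v \<in> L" for v
  proof -
    have vS: "v \<in> S" "v \<noteq> x" "v \<noteq> y" using that by (auto simp: L_def)
    have y: "{v, y} \<in> E \<longleftrightarrow> v \<in> {u, w}"
      unfolding uw(1)[symmetric] using vS by (auto simp: nbrs_def insert_commute)
    have x: "{v, x} \<in> E" using hub that by (auto simp: L_def insert_commute)
    have "nbrs S v = {t \<in> L. {v, t} \<in> E} \<union> {x} \<union> (if v \<in> {u, w} then {y} else {})"
      using x y xy by (auto simp: nbrs_def L_def)
    moreover have "x \<notin> {t \<in> L. {v, t} \<in> E}" "y \<notin> {t \<in> L. {v, t} \<in> E}" by (auto simp: L_def)
    moreover have "card (nbrs S v) = 3" using deg3 that by (simp add: deg_in_def L_def)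
    ultimately show ?thesis using finL xy by (auto split: if_splits)
  qed
  obtain p m where m: "2 \<le> m" and bij: "bij_betw p {1..m} L" and ends: "p 1 = u" "p m = w"
    and step: "\<And>i. i \<in> {1..<m} \<Longrightarrow> {p i, p (Suc i)} \<in> E"
    and adj: "\<And>i j. i \<in> {1..m} \<Longrightarrow> j \<in> {1..m} \<Longrightarrow> {p i, p j} \<in> E \<Longrightarrow> j = Suc i \<or> i = Suc j"
  proof (rule path_enumeration[of L "\<lambda>a b. {a, b} \<in> E" u w])
    show "\<exists>v\<in>D. card {t \<in> D. {v, t} \<in> E} \<le> 1" if "D \<subseteq> L" "D \<noteq> {}" for D
      using sparse that by (simp add: L_def deg_in_def nbrs_def)
  qed (use finL uL wL uw degL edge_neq[of a a for a] in \<open>auto simp: insert_commute\<close>)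
  \<comment> \<open>The m vertices of the path and the two connectors give n = m + 2, and m \<ge> 2
    yields n \<ge> 4.\<close>
  define \<phi> where "\<phi> h = (case h of ConnX \<Rightarrow> x | ConnY \<Rightarrow> y | PathV i \<Rightarrow> p i)" for h
  have \<phi>: "\<phi> ConnX = x" "\<phi> ConnY = y" "\<And>i. \<phi> (PathV i) = p i" by (simp_all add: \<phi>_def)
  have range: "p ` {1..m} = L" and inj: "inj_on p {1..m}" using bij by (auto simp: bij_betw_def)
  have inL: "p i \<in> L" if "i \<in> {1..m}" for i using range that by auto
  have vH: "verts (H_graph (m + 2)) = {ConnX, ConnY} \<union> PathV ` {1..m}" by (simp add: verts_H_graph)
  have ne: "p i \<noteq> x" "p i \<noteq> y" "x \<noteq> p i" "y \<noteq> p i" if "i \<in> {1..m}" for i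
    using inL[OF that] by (auto simp: L_def)
  have "inj_on \<phi> (verts (H_graph (m + 2)))"
    unfolding vH
  proof (rule inj_onI)
    fix a b
    assume ab: "a \<in> {ConnX, ConnY} \<union> PathV ` {1..m}" "b \<in> {ConnX, ConnY} \<union> PathV ` {1..m}"
      and eq: "\<phi> a = \<phi> b"
    show "a = b"
    proof (cases a)
      case a: (PathV i)
      then have i: "i \<in> {1..m}" using ab by auto
      show ?thesis
      proof (cases b)
        case b: (PathV j)
        then have "j \<in> {1..m}" using ab by auto
        then show ?thesis using inj_onD[OF inj _ i] eq a b \<phi> by simp
      qed (use a eq \<phi> ne[OF i] in simp_all)
    next
      case a: ConnX
      show ?thesis
      proof (cases b)
        case (PathV j)
        then have "j \<in> {1..m}" using ab by auto
        then show ?thesis using eq a PathV \<phi> ne[of j] by simp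
      qed (use a eq \<phi> xy(3) in auto)
    next
      case a: ConnY
      show ?thesis
      proof (cases b)
        case (PathV j)
        then have "j \<in> {1..m}" using ab by auto
        then show ?thesis using eq a PathV \<phi> ne[of j] by simp
      qed (use a eq \<phi> xy(3) in auto)
    qed
  qed
  moreover have "\<phi> ` verts (H_graph (m + 2)) = S"
    unfolding vH image_Un image_image using \<phi> range xy by (auto simp: L_def)
  moreover have "edges_in S - {{x, y}} = (`) \<phi> ` edges (H_graph (m + 2))"
  proof
    show "edges_in S - {{x, y}} \<subseteq> (`) \<phi> ` edges (H_graph (m + 2))"
    proof
      fix e assume e: "e \<in> edges_in S - {{x, y}}"
      then have "e \<in> E" by (simp add: edges_in_def)
      then obtain a b where ab: "e = {a, b}" "a \<noteq> b" by (meson edge_exE)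
      have eE: "{a, b} \<in> E" and S: "a \<in> S" "b \<in> S" and nxy: "{a, b} \<noteq> {x, y}"
        using e ab by (auto simp: edges_in_def)
      have hubc: "{x, v} \<in> (`) \<phi> ` edges (H_graph (m + 2))" if "v \<in> L" for v
      proof -
        have "v \<in> p ` {1..m}" using that range by simp
        then obtain i where "i \<in> {1..m}" "v = p i" by blast
        then show ?thesis by (intro image_eqI[of _ _ "{ConnX, PathV i}"]) (auto simp: \<phi> edges_H_graph)
      qed
      have yc: "{y, v} \<in> (`) \<phi> ` edges (H_graph (m + 2))" if "v \<in> L" "{y, v} \<in> E" for v
      proof -
        have "v \<in> nbrs (S - {x}) y" using that by (auto simp: nbrs_def L_def)
        then consider "v = p 1" | "v = p m" using uw ends by auto
        then show ?thesis
        proof cases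
          case 1
          then show ?thesis by (intro image_eqI[of _ _ "{ConnY, PathV 1}"]) (auto simp: \<phi> edges_H_graph)
        next
          case 2
          then show ?thesis by (intro image_eqI[of _ _ "{ConnY, PathV m}"]) (auto simp: \<phi> edges_H_graph)
        qed
      qed
      have pc: "{p i, p (Suc i)} \<in> (`) \<phi> ` edges (H_graph (m + 2))" if "i \<in> {1..<m}" for i
      proof (rule image_eqI[of _ _ "{PathV i, PathV (Suc i)}"])
        have "i \<in> {1..m + 2 - 3}" using that by auto
        then show "{PathV i, PathV (Suc i)} \<in> edges (H_graph (m + 2))"
          unfolding edges_H_graph by auto
      qed (simp add: \<phi>)
      consider "a = x" "b \<in> L" | "b = x" "a \<in> L" | "a = y" "b \<in> L" | "b = y" "a \<in> L" | "a \<in> L" "b \<in> L"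
        using S nxy ab by (auto simp: L_def)
      then show "e \<in> (`) \<phi> ` edges (H_graph (m + 2))"
      proof cases
        case 1 then show ?thesis using hubc ab by simp
      next
        case 2 then show ?thesis using hubc[of a] ab by (simp add: insert_commute)
      next
        case 3 then show ?thesis using yc ab eE by simp
      next
        case 4 then show ?thesis using yc[of a] ab eE by (simp add: insert_commute)
      next
        case 5
        then obtain i j where ij: "i \<in> {1..m}" "j \<in> {1..m}" "a = p i" "b = p j" using range by blast
        then have "j = Suc i \<or> i = Suc j" using adj eE by simp
        then show ?thesis using pc[of i] pc[of j] ij ab by (auto simp: insert_commute)
      qed
    qed
    have pS: "p i \<in> S" "p i \<noteq> x" "p i \<noteq> y" "{x, p i} \<in> E" if "i \<in> {1..m}" for i
      using inL[OF that] hub by (auto simp: L_def)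
    have yE: "{y, p 1} \<in> E" "{y, p m} \<in> E" using uw ends by (auto simp: nbrs_def)
    have "{p i, p (i + 1)} \<in> edges_in S - {{x, y}}" if "i \<in> {1..m + 2 - 3}" for i
    proof -
      have i: "i \<in> {1..<m}" "i \<in> {1..m}" "i + 1 \<in> {1..m}" using that m by auto
      show ?thesis
        using step[OF i(1)] pS[OF i(2)] pS[OF i(3)] by (auto simp: edges_in_def doubleton_eq_iff)
    qed
    moreover have "{x, p i} \<in> edges_in S - {{x, y}}" if "i \<in> {1..m}" for i
      using pS[OF that] xy by (auto simp: edges_in_def doubleton_eq_iff)
    moreover have "{y, p 1} \<in> edges_in S - {{x, y}}" "{y, p m} \<in> edges_in S - {{x, y}}"
      using yE pS[of 1] pS[of m] m xy by (auto simp: edges_in_def doubleton_eq_iff)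
    ultimately show "(`) \<phi> ` edges (H_graph (m + 2)) \<subseteq> edges_in S - {{x, y}}"
      unfolding edges_H_graph image_Un image_image image_insert image_empty \<phi>
      by (simp add: image_subset_iff)
  qed
  ultimately show ?thesis using that[of "m + 2" \<phi>] \<phi> m by simp
qed

end

section \<open>Isomorphisms and the converse direction\<close>

lemma map_graph_cong:
  assumes "\<And>v. v \<in> verts G \<Longrightarrow> f v = g v" "\<Union> (edges G) \<subseteq> verts G"
  shows "map_graph f G = map_graph g G"
proof -
  have "f ` e = g ` e" if "e \<in> edges G" for e
    using assms that by (intro image_cong) auto
  then show ?thesis using assms(1) by (simp add: map_graph_def)
qed

lemma map_graph_comp: "map_graph f (map_graph g G) = map_graph (f \<circ> g) G"
  by (simp add: map_graph_def image_image image_comp)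

lemma map_graph_id: "map_graph (\<lambda>v. v) G = G"
  by (simp add: map_graph_def)

lemma map_graph_sel:
  "verts (map_graph f G) = f ` verts G" "edges (map_graph f G) = (`) f ` edges G"
  by (simp_all add: map_graph_def)

text \<open>The inverse of f is controlled only on images of vertices, hence the condition that
  edges consist of vertices.\<close>

lemma isomorphic_sym:
  assumes "isomorphic G H" "\<Union> (edges G) \<subseteq> verts G"
  shows "isomorphic H G"
proof -
  obtain f where f: "inj_on f (verts G)" "map_graph f G = H"
    using assms(1) by (auto simp: isomorphic_def)
  let ?g = "inv_into (verts G) f"
  have "map_graph ?g H = map_graph (?g \<circ> f) G" by (simp add: f(2)[symmetric] map_graph_comp)
  also have "\<dots> = map_graph (\<lambda>v. v) G" using f(1) assms(2) by (intro map_graph_cong) auto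
  finally have "map_graph ?g H = G" by (simp add: map_graph_id)
  moreover have "inj_on ?g (verts H)"
    unfolding f(2)[symmetric] map_graph_sel by (rule inj_on_inv_into) simp
  ultimately show ?thesis by (auto simp: isomorphic_def)
qed

lemma isomorphic_trans:
  assumes "isomorphic G H" "isomorphic H K"
  shows "isomorphic G K"
proof -
  obtain f g where f: "inj_on f (verts G)" "map_graph f G = H"
    and g: "inj_on g (verts H)" "map_graph g H = K"
    using assms by (auto simp: isomorphic_def)
  have "inj_on (g \<circ> f) (verts G)" using f g by (auto simp: map_graph_def intro: comp_inj_on)
  moreover have "map_graph (g \<circ> f) G = K" using f g by (simp add: map_graph_comp[symmetric])
  ultimately show ?thesis by (auto simp: isomorphic_def)
qed

lemma map_graph_edges_sub:
  "\<Union> (edges G) \<subseteq> verts G \<Longrightarrow> \<Union> (edges (map_graph f G)) \<subseteq> verts (map_graph f G)"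
  unfolding map_graph_sel by blast

lemma simple_graph_edges_sub: "simple_graph G \<Longrightarrow> \<Union> (edges G) \<subseteq> verts G"
  by (auto simp: simple_graph_def)

section \<open>Edges, size and degrees of \<open>H_graph\<close>\<close>

lemma H_graph_edge_cases:
  assumes "e \<in> edges (H_graph n)"
  obtains (path) i where "i \<in> {1..n-3}" "e = {PathV i, PathV (i + 1)}"
    | (spoke) i where "i \<in> {1..n-2}" "e = {ConnX, PathV i}"
    | (first) "e = {ConnY, PathV 1}"
    | (last) "e = {ConnY, PathV (n - 2)}"
  using assms unfolding edges_H_graph by blast

lemma simple_H_graph:
  assumes "4 \<le> n"
  shows "simple_graph (H_graph n)"
proof -
  have "e \<subseteq> verts (H_graph n) \<and> card e = 2" if "e \<in> edges (H_graph n)" for e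
    using that
  proof (cases rule: H_graph_edge_cases)
    case (path i)
    then have "i \<in> {1..n-2}" "i + 1 \<in> {1..n-2}" using assms by auto
    then show ?thesis using path by (simp add: verts_H_graph)
  qed (use assms in \<open>auto simp: verts_H_graph\<close>)
  moreover have "finite (verts (H_graph n))" by (simp add: verts_H_graph)
  ultimately show ?thesis by (simp add: simple_graph_def)
qed

lemma H_graph_edges_sub: "4 \<le> n \<Longrightarrow> edges (H_graph n) \<subseteq> Pow (verts (H_graph n))"
  using simple_H_graph[of n] by (auto simp: simple_graph_def)

lemma inj_on_edges:
  assumes "inj_on \<phi> (verts (H_graph n))" "4 \<le> n"
  shows "inj_on ((`) \<phi>) (edges (H_graph n))"
  using inj_on_image_Pow[OF assms(1)] H_graph_edges_sub[OF assms(2)] by (rule inj_on_subset)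

lemma card_verts_H_graph: "4 \<le> n \<Longrightarrow> card (verts (H_graph n)) = n"
proof -
  assume n: "4 \<le> n"
  have "card (PathV ` {1..n-2}) = n - 2" by (simp add: card_image inj_on_def)
  moreover have "card ({ConnX, ConnY} \<union> PathV ` {1..n-2}) = card {ConnX, ConnY} + card (PathV ` {1..n-2})"
    by (rule card_Un_disjoint) auto
  ultimately show ?thesis using n by (simp add: verts_H_graph)
qed

lemma card_edges_H_graph: "4 \<le> n \<Longrightarrow> card (edges (H_graph n)) = 2 * n - 3"
proof -
  assume n: "4 \<le> n"
  define P where "P = (\<lambda>i. {PathV i, PathV (i+1)}) ` {1..n-3}"
  define X where "X = (\<lambda>i. {ConnX, PathV i}) ` {1..n-2}"
  define Y where "Y = {{ConnY, PathV 1}, {ConnY, PathV (n-2)}}"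
  have "inj_on (\<lambda>i. {PathV i, PathV (i+1)}) {1..n-3}" by (auto simp: inj_on_def doubleton_eq_iff)
  then have cP: "card P = n - 3" by (simp add: P_def card_image)
  have "inj_on (\<lambda>i. {ConnX, PathV i}) {1..n-2}" by (auto simp: inj_on_def doubleton_eq_iff)
  then have cX: "card X = n - 2" by (simp add: X_def card_image)
  have cY: "card Y = 2" using n by (auto simp: Y_def doubleton_eq_iff)
  have fin: "finite P" "finite X" "finite Y" by (simp_all add: P_def X_def Y_def)
  have "P \<inter> X = {}" by (auto simp: P_def X_def doubleton_eq_iff)
  then have "card (P \<union> X) = card P + card X" using fin by (intro card_Un_disjoint)
  moreover have "(P \<union> X) \<inter> Y = {}" by (auto simp: P_def X_def Y_def doubleton_eq_iff)
  then have "card (P \<union> X \<union> Y) = card (P \<union> X) + card Y" using fin by (intro card_Un_disjoint) auto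
  ultimately have "card (P \<union> X \<union> Y) = 2 * n - 3" using cP cX cY n by linarith
  then show ?thesis by (simp only: edges_H_graph P_def X_def Y_def)
qed

text \<open>The two connectors are not adjacent. This keeps the edge sets of two glued copies
  disjoint, and it gives a subgraph with an edge in a copy a path vertex to spread from.\<close>

lemma H_graph_edge_path:
  assumes "4 \<le> n" "e \<in> edges (H_graph n)"
  obtains i where "i \<in> {1..n-2}" "PathV i \<in> e"
  using assms(2)
proof (cases rule: H_graph_edge_cases)
  case (path i)
  then show ?thesis using that[of i] by auto
next
  case (spoke i)
  then show ?thesis using that[of i] by auto
next
  case first
  then show ?thesis using that[of 1] assms(1) by auto
next
  case last
  then show ?thesis using that[of "n - 2"] assms(1) by auto
qed

lemma star_ConnY: "{e \<in> edges (H_graph n). ConnY \<in> e} \<subseteq> {{ConnY, PathV 1}, {ConnY, PathV (n-2)}}"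
  unfolding edges_H_graph by auto

text \<open>Apart from the spoke there is one edge on either side, where the edge to
  \<open>ConnY\<close> replaces the missing path edge at an end.\<close>

lemma star_PathV:
  assumes "i \<in> {1..n-2}"
  shows "card {e \<in> edges (H_graph n). PathV i \<in> e} \<le> 3"
proof -
  let ?l = "if i = 1 then {ConnY, PathV 1} else {PathV (i - 1), PathV i}"
  let ?r = "if i = n - 2 then {ConnY, PathV (n-2)} else {PathV i, PathV (i + 1)}"
  have "{e \<in> edges (H_graph n). PathV i \<in> e} \<subseteq> {{ConnX, PathV i}, ?l, ?r}"
  proof
    fix e assume "e \<in> {e \<in> edges (H_graph n). PathV i \<in> e}"
    then have e: "e \<in> edges (H_graph n)" "PathV i \<in> e" by auto
    from e(1) show "e \<in> {{ConnX, PathV i}, ?l, ?r}"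
      by (cases rule: H_graph_edge_cases) (use e(2) assms in auto)
  qed
  then have "card {e \<in> edges (H_graph n). PathV i \<in> e} \<le> card {{ConnX, PathV i}, ?l, ?r}"
    by (intro card_mono) auto
  also have "\<dots> \<le> 3"
    using card_length[of "[{ConnX, PathV i}, ?l, ?r]"] by simp
  finally show ?thesis .
qed

section \<open>Subgraphs of minimum degree 3 in wheels and glued graphs\<close>

lemma full_star:
  assumes "subgraph M G" "simple_graph G" "3 \<le> degree M v" "degree G v \<le> 3" "e \<in> edges G" "v \<in> e"
  shows "e \<in> edges M"
proof -
  have "finite (edges G)" using assms(2) by (rule sgraph.finite_E[OF sgraph.intro])
  then have fin: "finite {e \<in> edges G. v \<in> e}" by simp
  have "{e \<in> edges M. v \<in> e} = {e \<in> edges G. v \<in> e}"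
    using assms(1,3,4) fin by (intro card_seteq) (auto simp: subgraph_def degree_def)
  then show ?thesis using assms(5,6) by blast
qed

text \<open>By \<open>full\<close>, a path vertex has no edge outside the copy, so its degree in G
  is at most 3 and M contains all its edges as soon as it contains the vertex. Hence M contains the
  neighbours along the path, then the whole path, and then every edge of the copy, as each contains
  a path vertex.\<close>

lemma path_spread:
  assumes G: "simple_graph G" and n: "4 \<le> n" and inj: "inj_on \<phi> (verts (H_graph n))"
    and sub: "(`) \<phi> ` edges (H_graph n) \<subseteq> edges G"
    and full: "\<forall>e\<in>edges G. \<forall>i\<in>{1..n-2}. \<phi> (PathV i) \<in> e \<longrightarrow> e \<in> (`) \<phi> ` edges (H_graph n)"
    and M: "subgraph M G" and deg: "\<forall>v\<in>verts M. 3 \<le> degree M v"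
    and k: "k \<in> {1..n-2}" "\<phi> (PathV k) \<in> verts M"
  shows "(`) \<phi> ` edges (H_graph n) \<subseteq> edges M" "\<phi> ` verts (H_graph n) \<subseteq> verts M"
proof -
  have simpleH: "\<And>e. e \<in> edges (H_graph n) \<Longrightarrow> e \<subseteq> verts (H_graph n)"
    using H_graph_edges_sub[OF n] by blast
  have deg3: "degree G (\<phi> (PathV i)) \<le> 3" if i: "i \<in> {1..n-2}" for i
  proof -
    have fin: "finite (edges (H_graph n))"
      using simple_H_graph[OF n] by (rule sgraph.finite_E[OF sgraph.intro])
    have "{e \<in> edges G. \<phi> (PathV i) \<in> e} \<subseteq> (`) \<phi> ` {e \<in> edges (H_graph n). PathV i \<in> e}"
    proof
      fix e assume e: "e \<in> {e \<in> edges G. \<phi> (PathV i) \<in> e}"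
      then obtain d where d: "d \<in> edges (H_graph n)" "e = \<phi> ` d" using full i by blast
      have "PathV i \<in> verts (H_graph n)" using i by (simp add: verts_H_graph)
      then have "PathV i \<in> d" using e d simpleH[OF d(1)] inj by (auto dest: inj_onD)
      then show "e \<in> (`) \<phi> ` {e \<in> edges (H_graph n). PathV i \<in> e}" using d by blast
    qed
    then have "degree G (\<phi> (PathV i)) \<le> card ((`) \<phi> ` {e \<in> edges (H_graph n). PathV i \<in> e})"
      unfolding degree_def using fin by (intro card_mono) auto
    also have "\<dots> \<le> card {e \<in> edges (H_graph n). PathV i \<in> e}"
      using fin by (intro card_image_le) auto
    also have "\<dots> \<le> 3" using star_PathV[OF i] .
    finally show ?thesis .
  qed
  have star: "\<phi> ` d \<in> edges M" "\<phi> ` d \<subseteq> verts M"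
    if "i \<in> {1..n-2}" "\<phi> (PathV i) \<in> verts M" "d \<in> edges (H_graph n)" "PathV i \<in> d" for i d
  proof -
    show "\<phi> ` d \<in> edges M"
      using full_star[OF M G _ deg3[OF that(1)], of "\<phi> ` d"] deg that sub by blast
    then show "\<phi> ` d \<subseteq> verts M" using M by (simp add: subgraph_def simple_graph_def)
  qed
  have step: "\<phi> (PathV i) \<in> verts M \<longleftrightarrow> \<phi> (PathV (Suc i)) \<in> verts M" if "1 \<le> i" "Suc i \<le> n - 2" for i
  proof -
    have i: "i \<in> {1..n-3}" "i \<in> {1..n-2}" "Suc i \<in> {1..n-2}" using that by auto
    then have "{PathV i, PathV (Suc i)} \<in> edges (H_graph n)" unfolding edges_H_graph by auto
    then show ?thesis
      using star(2)[OF i(2), of "{PathV i, PathV (Suc i)}"]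
        star(2)[OF i(3), of "{PathV i, PathV (Suc i)}"] by auto
  qed
  \<comment> \<open>First down the path from k to 1; \<open>all\<close> then goes up again from
    1.\<close>
  have one: "\<phi> (PathV 1) \<in> verts M"
  proof -
    have "1 \<le> k" using k by auto
    then have "k \<le> n - 2 \<longrightarrow> \<phi> (PathV k) \<in> verts M \<longrightarrow> \<phi> (PathV 1) \<in> verts M"
      by (induction rule: dec_induct) (use step in auto)
    then show ?thesis using k by simp
  qed
  have all: "\<phi> (PathV i) \<in> verts M" if "i \<in> {1..n-2}" for i
  proof -
    have "1 \<le> i" using that by auto
    then have "i \<le> n - 2 \<longrightarrow> \<phi> (PathV i) \<in> verts M"
      by (induction rule: dec_induct) (use step one in auto)
    then show ?thesis using that by simp
  qed
  have "\<phi> ` d \<in> edges M" if d: "d \<in> edges (H_graph n)" for d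
  proof -
    obtain i where "i \<in> {1..n-2}" "PathV i \<in> d" using H_graph_edge_path[OF n d] .
    then show ?thesis using star(1) all d by blast
  qed
  then show "(`) \<phi> ` edges (H_graph n) \<subseteq> edges M" by blast
  have 1: "(1::nat) \<in> {1..n-2}" using n by auto
  have "{ConnX, PathV 1} \<in> edges (H_graph n)" "{ConnY, PathV 1} \<in> edges (H_graph n)"
    using 1 unfolding edges_H_graph by auto
  then have "\<phi> ConnX \<in> verts M" "\<phi> ConnY \<in> verts M"
    using star(2)[OF 1 one, of "{ConnX, PathV 1}"] star(2)[OF 1 one, of "{ConnY, PathV 1}"] by auto
  then show "\<phi> ` verts (H_graph n) \<subseteq> verts M" using all unfolding verts_H_graph by blast
qed

text \<open>A subgraph that contains all vertices and edges of G is G itself, so under the last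
  hypothesis no proper one has minimum degree 3.\<close>

lemma extremalI:
  assumes "simple_graph G" "2 \<le> card (verts G)" "card (edges G) = 2 * card (verts G) - 2"
    and "\<And>M. subgraph M G \<Longrightarrow> verts M \<noteq> {} \<Longrightarrow> \<forall>v\<in>verts M. 3 \<le> degree M v \<Longrightarrow>
      verts G \<subseteq> verts M \<and> edges G \<subseteq> edges M"
  shows "G \<in> extremal_family"
proof -
  have "H = G" if H: "subgraph H G" "verts H \<noteq> {}" "3 \<le> min_degree H" for H
  proof -
    have "finite (verts H)" using H(1) by (simp add: subgraph_def simple_graph_def)
    then have "min_degree H \<le> degree H v" if "v \<in> verts H" for v
      using that by (simp add: min_degree_def)
    then have "\<forall>v\<in>verts H. 3 \<le> degree H v" using H(3) by (meson le_trans)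
    then have "verts G \<subseteq> verts H" "edges G \<subseteq> edges H" using assms(4)[OF H(1,2)] by blast+
    then show "H = G" using H(1) by (intro graph.expand) (auto simp: subgraph_def)
  qed
  then show ?thesis using assms(1-3) by (auto simp: extremal_family_def)
qed

text \<open>\<open>H_graph n\<close> has 2n - 3 edges, and joining the connectors adds one. A
  subgraph of minimum degree 3 spreads along the path and then, at \<open>ConnY\<close>, to the
  added edge.\<close>

lemma wheel_extremal:
  assumes G: "simple_graph G" and w: "wheel_embedding \<phi> n G"
  shows "G \<in> extremal_family"
proof -
  have n: "4 \<le> n" and inj: "inj_on \<phi> (verts (H_graph n))"
    and V: "verts G = \<phi> ` verts (H_graph n)"
    and E: "edges G = insert {\<phi> ConnX, \<phi> ConnY} ((`) \<phi> ` edges (H_graph n))"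
    using w by (auto simp: wheel_embedding_def)
  have XY: "ConnX \<in> verts (H_graph n)" "ConnY \<in> verts (H_graph n)" by (auto simp: verts_H_graph)
  have PV: "PathV i \<in> verts (H_graph n)" if "i \<in> {1..n-2}" for i using that by (simp add: verts_H_graph)
  have nP: "\<phi> (PathV i) \<notin> {\<phi> ConnX, \<phi> ConnY}" if "i \<in> {1..n-2}" for i
    using inj_onD[OF inj _ PV[OF that] XY(1)] inj_onD[OF inj _ PV[OF that] XY(2)] by auto
  have nXY: "{\<phi> ConnX, \<phi> ConnY} \<notin> (`) \<phi> ` edges (H_graph n)"
  proof
    assume "{\<phi> ConnX, \<phi> ConnY} \<in> (`) \<phi> ` edges (H_graph n)"
    then obtain d where d: "d \<in> edges (H_graph n)" "{\<phi> ConnX, \<phi> ConnY} = \<phi> ` d" by blast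
    obtain i where "i \<in> {1..n-2}" "PathV i \<in> d" using H_graph_edge_path[OF n d(1)] .
    then show False using nP[of i] d(2) by blast
  qed
  have cV: "card (verts G) = n" using V card_image[OF inj] card_verts_H_graph[OF n] by simp
  have fin: "finite (edges (H_graph n))"
    using simple_H_graph[OF n] by (rule sgraph.finite_E[OF sgraph.intro])
  have "card (edges G) = card (edges (H_graph n)) + 1"
    unfolding E using nXY fin card_image[OF inj_on_edges[OF inj n]] by simp
  then have cE: "card (edges G) = 2 * card (verts G) - 2" using card_edges_H_graph[OF n] cV n by simp
  show ?thesis
  proof (rule extremalI[OF G _ cE])
    show "2 \<le> card (verts G)" using cV n by simp
    fix M assume M: "subgraph M G" "verts M \<noteq> {}" and deg: "\<forall>v\<in>verts M. 3 \<le> degree M v"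
    have subM: "\<And>e. e \<in> edges M \<Longrightarrow> e \<subseteq> verts M \<and> e \<in> edges G"
      using M(1) by (auto simp: subgraph_def simple_graph_def)
    \<comment> \<open>Without path vertices M could have no edge but the one joining the connectors,
      too few for degree 3.\<close>
    have "\<exists>k\<in>{1..n-2}. \<phi> (PathV k) \<in> verts M"
    proof (rule ccontr)
      assume no: "\<not> ?thesis"
      obtain v where v: "v \<in> verts M" using M(2) by blast
      have "{e \<in> edges M. v \<in> e} \<subseteq> {{\<phi> ConnX, \<phi> ConnY}}"
      proof
        fix e assume "e \<in> {e \<in> edges M. v \<in> e}"
        then have e: "e \<in> edges G" "e \<subseteq> verts M" using subM by auto
        have "e \<notin> (`) \<phi> ` edges (H_graph n)"
        proof
          assume "e \<in> (`) \<phi> ` edges (H_graph n)"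
          then obtain d where d: "d \<in> edges (H_graph n)" "e = \<phi> ` d" by blast
          obtain i where "i \<in> {1..n-2}" "PathV i \<in> d" using H_graph_edge_path[OF n d(1)] .
          then show False using no d(2) e(2) by blast
        qed
        then show "e \<in> {{\<phi> ConnX, \<phi> ConnY}}" using e(1) E by blast
      qed
      then have "degree M v \<le> 1" unfolding degree_def
        using card_mono[of "{{\<phi> ConnX, \<phi> ConnY}}" "{e \<in> edges M. v \<in> e}"] by simp
      then show False using deg v by fastforce
    qed
    then obtain k where k: "k \<in> {1..n-2}" "\<phi> (PathV k) \<in> verts M" by blast
    have sub: "(`) \<phi> ` edges (H_graph n) \<subseteq> edges G" using E by blast
    have full: "\<forall>e\<in>edges G. \<forall>i\<in>{1..n-2}. \<phi> (PathV i) \<in> e \<longrightarrow> e \<in> (`) \<phi> ` edges (H_graph n)"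
      using nP E by blast
    have spread: "(`) \<phi> ` edges (H_graph n) \<subseteq> edges M" "\<phi> ` verts (H_graph n) \<subseteq> verts M"
      by (fact path_spread[OF G n inj sub full M(1) deg k])+
    \<comment> \<open>In G the image of \<open>ConnY\<close> has degree at most 3 as well, so M also
      contains the edge between the connectors, the only one that \<open>spread\<close> does not
      give.\<close>
    have "{e \<in> edges G. \<phi> ConnY \<in> e} \<subseteq>
      {{\<phi> ConnX, \<phi> ConnY}, \<phi> ` {ConnY, PathV 1}, \<phi> ` {ConnY, PathV (n-2)}}"
    proof
      fix e assume e: "e \<in> {e \<in> edges G. \<phi> ConnY \<in> e}"
      show "e \<in> {{\<phi> ConnX, \<phi> ConnY}, \<phi> ` {ConnY, PathV 1}, \<phi> ` {ConnY, PathV (n-2)}}"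
      proof (cases "e = {\<phi> ConnX, \<phi> ConnY}")
        case False
        then obtain d where d: "d \<in> edges (H_graph n)" "e = \<phi> ` d" using e E by blast
        have "d \<subseteq> verts (H_graph n)" using H_graph_edges_sub[OF n] d(1) by blast
        then have "ConnY \<in> d" using e d(2) inj XY(2) by (auto dest: inj_onD)
        then show ?thesis using star_ConnY[of n] d by blast
      qed simp
    qed
    then have "degree G (\<phi> ConnY) \<le> card {{\<phi> ConnX, \<phi> ConnY}, \<phi> ` {ConnY, PathV 1}, \<phi> ` {ConnY, PathV (n-2)}}"
      unfolding degree_def by (intro card_mono) auto
    also have "\<dots> \<le> 3"
      using card_length[of "[{\<phi> ConnX, \<phi> ConnY}, \<phi> ` {ConnY, PathV 1}, \<phi> ` {ConnY, PathV (n-2)}]"] by simp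
    finally have "degree G (\<phi> ConnY) \<le> 3" .
    moreover have "\<phi> ConnY \<in> verts M" using spread(2) XY(2) by blast
    ultimately have "{\<phi> ConnX, \<phi> ConnY} \<in> edges M"
      using full_star[OF M(1) G, of "\<phi> ConnY"] deg E by blast
    then show "verts G \<subseteq> verts M \<and> edges G \<subseteq> edges M" using spread by (simp add: V E)
  qed
qed

lemma glued_sym: "glued \<phi> \<psi> i j G \<Longrightarrow> glued \<psi> \<phi> j i G"
  unfolding glued_def by (simp add: Int_commute Un_commute)

lemma glued_disjoint:
  assumes "glued \<phi> \<psi> i j G" "k \<in> {1..i-2}"
  shows "\<phi> (PathV k) \<notin> \<psi> ` verts (H_graph j)"
proof
  assume "\<phi> (PathV k) \<in> \<psi> ` verts (H_graph j)"
  moreover have P: "PathV k \<in> verts (H_graph i)" using assms(2) by (simp add: verts_H_graph)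
  ultimately have "\<phi> (PathV k) \<in> \<phi> ` {ConnX, ConnY}" using assms(1) unfolding glued_def by blast
  moreover have "{ConnX, ConnY} \<subseteq> verts (H_graph i)" by (auto simp: verts_H_graph)
  ultimately have "PathV k \<in> {ConnX, ConnY}"
    using assms(1) P inj_on_image_mem_iff unfolding glued_def by metis
  then show False by simp
qed

text \<open>Inside the first copy \<open>ConnY\<close> has only two edges, so its third edge in M
  lies in the second copy, whichever connector it is identified with there. Every edge of that copy
  contains a path vertex.\<close>

lemma glued_subgraph_path:
  assumes g: "glued \<phi> \<psi> i j G" and M: "subgraph M G" and deg: "\<forall>v\<in>verts M. 3 \<le> degree M v"
    and all: "\<phi> ` verts (H_graph i) \<subseteq> verts M"
  shows "\<exists>k\<in>{1..j-2}. \<psi> (PathV k) \<in> verts M"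
proof (rule ccontr)
  assume no: "\<not> ?thesis"
  have ij: "4 \<le> i" "4 \<le> j" and inj: "inj_on \<phi> (verts (H_graph i))"
    and E: "edges G = (`) \<phi> ` edges (H_graph i) \<union> (`) \<psi> ` edges (H_graph j)"
    using g by (simp_all add: glued_def)
  have Y: "ConnY \<in> verts (H_graph i)" by (simp add: verts_H_graph)
  have "{e \<in> edges M. \<phi> ConnY \<in> e} \<subseteq> {\<phi> ` {ConnY, PathV 1}, \<phi> ` {ConnY, PathV (i-2)}}"
  proof
    fix e assume "e \<in> {e \<in> edges M. \<phi> ConnY \<in> e}"
    then have e: "e \<in> edges G" "e \<subseteq> verts M" "\<phi> ConnY \<in> e"
      using M by (auto simp: subgraph_def simple_graph_def)
    have "e \<notin> (`) \<psi> ` edges (H_graph j)"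
    proof
      assume "e \<in> (`) \<psi> ` edges (H_graph j)"
      then obtain d where d: "d \<in> edges (H_graph j)" "e = \<psi> ` d" by blast
      obtain k where "k \<in> {1..j-2}" "PathV k \<in> d" using H_graph_edge_path[OF ij(2) d(1)] .
      then show False using no d(2) e(2) by blast
    qed
    then have "e \<in> (`) \<phi> ` edges (H_graph i)" using e(1) unfolding E by simp
    then obtain d where d: "d \<in> edges (H_graph i)" "e = \<phi> ` d" by blast
    have "d \<subseteq> verts (H_graph i)" using H_graph_edges_sub[OF ij(1)] d(1) by blast
    then have "ConnY \<in> d" using e(3) d(2) inj Y by (auto dest: inj_onD)
    then show "e \<in> {\<phi> ` {ConnY, PathV 1}, \<phi> ` {ConnY, PathV (i-2)}}"
      using star_ConnY[of i] d by blast
  qed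
  then have "degree M (\<phi> ConnY) \<le> card {\<phi> ` {ConnY, PathV 1}, \<phi> ` {ConnY, PathV (i-2)}}"
    unfolding degree_def by (intro card_mono) auto
  also have "\<dots> \<le> 2"
    using card_length[of "[\<phi> ` {ConnY, PathV 1}, \<phi> ` {ConnY, PathV (i-2)}]"] by simp
  finally have "\<not> 3 \<le> degree M (\<phi> ConnY)" by simp
  then show False using deg all Y by blast
qed

lemma glued_spread:
  assumes G: "simple_graph G" and g: "glued \<phi> \<psi> i j G" and M: "subgraph M G"
    and deg: "\<forall>v\<in>verts M. 3 \<le> degree M v"
    and k: "k \<in> {1..i-2}" "\<phi> (PathV k) \<in> verts M"
  shows "(`) \<phi> ` edges (H_graph i) \<subseteq> edges M" "\<phi> ` verts (H_graph i) \<subseteq> verts M"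
proof -
  have ij: "4 \<le> i" "4 \<le> j" and inj: "inj_on \<phi> (verts (H_graph i))"
    and E: "edges G = (`) \<phi> ` edges (H_graph i) \<union> (`) \<psi> ` edges (H_graph j)"
    using g by (simp_all add: glued_def)
  have sub: "(`) \<phi> ` edges (H_graph i) \<subseteq> edges G" using E by blast
  have "e \<in> (`) \<phi> ` edges (H_graph i)"
    if "e \<in> edges G" "l \<in> {1..i-2}" "\<phi> (PathV l) \<in> e" for e l
  proof (rule ccontr)
    assume "e \<notin> (`) \<phi> ` edges (H_graph i)"
    then have "e \<in> (`) \<psi> ` edges (H_graph j)" using that(1) unfolding E by simp
    then obtain d where d: "d \<in> edges (H_graph j)" "e = \<psi> ` d" by blast
    then have "e \<subseteq> \<psi> ` verts (H_graph j)" using H_graph_edges_sub[OF ij(2)] by blast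
    then show False using glued_disjoint[OF g that(2)] that(3) by blast
  qed
  then have full: "\<forall>e\<in>edges G. \<forall>l\<in>{1..i-2}. \<phi> (PathV l) \<in> e \<longrightarrow> e \<in> (`) \<phi> ` edges (H_graph i)"
    by blast
  show "(`) \<phi> ` edges (H_graph i) \<subseteq> edges M" "\<phi> ` verts (H_graph i) \<subseteq> verts M"
    by (fact path_spread[OF G ij(1) inj sub full M deg k])+
qed

text \<open>The copies share two vertices and no edge, which makes (2i - 3) + (2j - 3) edges on i +
  j - 2 vertices. A subgraph of minimum degree 3 fills a copy in which it has a path vertex, must
  then enter the other copy, and fills that too.\<close>

lemma glued_extremal:
  assumes G: "simple_graph G" and g: "glued \<phi> \<psi> i j G"
  shows "G \<in> extremal_family"
proof -
  have ij: "4 \<le> i" "4 \<le> j"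
    and inj: "inj_on \<phi> (verts (H_graph i))" "inj_on \<psi> (verts (H_graph j))"
    and int: "\<phi> ` verts (H_graph i) \<inter> \<psi> ` verts (H_graph j) = \<phi> ` {ConnX, ConnY}"
    and V: "verts G = \<phi> ` verts (H_graph i) \<union> \<psi> ` verts (H_graph j)"
    and E: "edges G = (`) \<phi> ` edges (H_graph i) \<union> (`) \<psi> ` edges (H_graph j)"
    using g by (simp_all add: glued_def)
  have fin: "finite (verts (H_graph m))" for m by (simp add: verts_H_graph)
  have finE: "finite (edges (H_graph m))" if "4 \<le> m" for m
    using simple_H_graph[OF that] by (rule sgraph.finite_E[OF sgraph.intro])
  have XY: "{ConnX, ConnY} \<subseteq> verts (H_graph i)" by (auto simp: verts_H_graph)
  have "card (\<phi> ` {ConnX, ConnY}) = 2" using card_image[OF inj_on_subset[OF inj(1) XY]] by simp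
  then have cV: "card (verts G) + 2 = i + j"
    using card_Un_Int[of "\<phi> ` verts (H_graph i)" "\<psi> ` verts (H_graph j)"] fin
      card_image[OF inj(1)] card_image[OF inj(2)] card_verts_H_graph ij V int by simp
  have "(`) \<phi> ` edges (H_graph i) \<inter> (`) \<psi> ` edges (H_graph j) = {}"
  proof (rule ccontr)
    assume "\<not> ?thesis"
    then obtain c d where cd: "c \<in> edges (H_graph i)" "d \<in> edges (H_graph j)" "\<phi> ` c = \<psi> ` d" by blast
    obtain k where k: "k \<in> {1..i-2}" "PathV k \<in> c" using H_graph_edge_path[OF ij(1) cd(1)] .
    have "\<psi> ` d \<subseteq> \<psi> ` verts (H_graph j)" using H_graph_edges_sub[OF ij(2)] cd(2) by blast
    moreover have "\<phi> (PathV k) \<in> \<psi> ` d" unfolding cd(3)[symmetric] using k(2) by (rule imageI)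
    ultimately show False using glued_disjoint[OF g k(1)] by (meson subsetD)
  qed
  then have "card (edges G) = card ((`) \<phi> ` edges (H_graph i)) + card ((`) \<psi> ` edges (H_graph j))"
    unfolding E using finE ij by (intro card_Un_disjoint) auto
  also have "\<dots> = (2 * i - 3) + (2 * j - 3)"
    using card_image[OF inj_on_edges[OF inj(1) ij(1)]] card_image[OF inj_on_edges[OF inj(2) ij(2)]]
      card_edges_H_graph ij by simp
  finally have cE: "card (edges G) = 2 * card (verts G) - 2" using cV ij by linarith
  show ?thesis
  proof (rule extremalI[OF G _ cE])
    show "2 \<le> card (verts G)" using cV ij by linarith
    fix M assume M: "subgraph M G" "verts M \<noteq> {}" and deg: "\<forall>v\<in>verts M. 3 \<le> degree M v"
    obtain v where v: "v \<in> verts M" using M(2) by blast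
    have "card {e \<in> edges M. v \<in> e} \<noteq> 0" using deg v unfolding degree_def by fastforce
    then have "{e \<in> edges M. v \<in> e} \<noteq> {}" by (metis card.empty)
    then obtain e where e: "e \<in> edges M" by blast
    then have eM: "e \<subseteq> verts M" and eG: "e \<in> edges G" using M(1) by (auto simp: subgraph_def simple_graph_def)
    have "(\<exists>k\<in>{1..i-2}. \<phi> (PathV k) \<in> verts M) \<or> (\<exists>k\<in>{1..j-2}. \<psi> (PathV k) \<in> verts M)"
    proof -
      from eG consider c where "c \<in> edges (H_graph i)" "e = \<phi> ` c"
        | d where "d \<in> edges (H_graph j)" "e = \<psi> ` d"
        unfolding E by (elim UnE imageE)
      then show ?thesis
      proof cases
        case 1
        obtain k where "k \<in> {1..i-2}" "PathV k \<in> c" using H_graph_edge_path[OF ij(1) 1(1)] .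
        then show ?thesis using 1(2) eM by blast
      next
        case 2
        obtain k where "k \<in> {1..j-2}" "PathV k \<in> d" using H_graph_edge_path[OF ij(2) 2(1)] .
        then show ?thesis using 2(2) eM by blast
      qed
    qed
    moreover have "\<exists>k\<in>{1..j-2}. \<psi> (PathV k) \<in> verts M"
      if "k \<in> {1..i-2}" "\<phi> (PathV k) \<in> verts M" for k
      by (rule glued_subgraph_path[OF g M(1) deg glued_spread(2)[OF G g M(1) deg that]])
    moreover have "\<exists>k\<in>{1..i-2}. \<phi> (PathV k) \<in> verts M"
      if "k \<in> {1..j-2}" "\<psi> (PathV k) \<in> verts M" for k
      by (rule glued_subgraph_path[OF glued_sym[OF g] M(1) deg
            glued_spread(2)[OF G glued_sym[OF g] M(1) deg that]])
    ultimately obtain k l where k: "k \<in> {1..i-2}" "\<phi> (PathV k) \<in> verts M"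
      and l: "l \<in> {1..j-2}" "\<psi> (PathV l) \<in> verts M" by meson
    show "verts G \<subseteq> verts M \<and> edges G \<subseteq> edges M"
      using glued_spread[OF G g M(1) deg k] glued_spread[OF G glued_sym[OF g] M(1) deg l]
      by (simp add: V E)
  qed
qed

section \<open>Wheels and glued graphs as images of \<open>H_graph\<close>\<close>

lemma wheel_isomorphic_H_graph:
  assumes "4 \<le> n"
  shows "isomorphic (wheel n) (Graph (verts (H_graph n)) (insert {ConnX, ConnY} (edges (H_graph n))))"
proof -
  \<comment> \<open>This turns truncated differences into successors: n - 1, n - 2, n - 3 are k + 2,
    k + 1, k.\<close>
  define k where "k = n - 3"
  have n: "n = Suc (Suc (Suc k))" "1 \<le> k" using assms by (auto simp: k_def)
  \<comment> \<open>The rim vertex with the last index becomes \<open>ConnY\<close>; removing it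
    from the rim leaves the path.\<close>
  define h where "h w = (case w of Hub \<Rightarrow> ConnX | Rim i \<Rightarrow> if i = n - 1 then ConnY else PathV i)" for w
  have h: "h Hub = ConnX" "\<And>i. h (Rim i) = (if i = n - 1 then ConnY else PathV i)" by (simp_all add: h_def)
  have V: "verts (wheel n) = insert Hub (Rim ` {1..n-1})"
    and E: "edges (wheel n) = (\<lambda>i. {Hub, Rim i}) ` {1..n-1} \<union>
      (\<lambda>i. {Rim i, Rim (i mod (n-1) + 1)}) ` {1..n-1}" by (simp_all add: wheel_def)
  \<comment> \<open>The rim edges that start at the last two indices are those at
    \<open>ConnY\<close>, so these indices are split off; the very last edge closes the cycle and
    goes to \<open>PathV 1\<close>.\<close>
  have set2: "{1..n-1} = insert (Suc (Suc k)) {1..n-2}" "{1..n-2} = insert (Suc k) {1..n-3}"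
    using n by auto
  have "inj_on h (verts (wheel n))"
    unfolding V by (auto simp: inj_on_def h split: if_splits)
  moreover have "h ` verts (wheel n) = verts (H_graph n)"
  proof -
    have "(\<lambda>i. h (Rim i)) ` {1..n-2} = PathV ` {1..n-2}" using n by (intro image_cong) (auto simp: h)
    then show ?thesis unfolding V verts_H_graph set2(1) image_insert image_image using n by (auto simp: h)
  qed
  moreover have "(`) h ` edges (wheel n) = insert {ConnX, ConnY} (edges (H_graph n))"
  proof -
    have spokes: "(\<lambda>i. {h Hub, h (Rim i)}) ` {1..n-1} = insert {ConnX, ConnY} ((\<lambda>i. {ConnX, PathV i}) ` {1..n-2})"
    proof -
      have "(\<lambda>i. {h Hub, h (Rim i)}) ` {1..n-2} = (\<lambda>i. {ConnX, PathV i}) ` {1..n-2}"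
        using n by (intro image_cong) (auto simp: h)
      then show ?thesis unfolding set2(1) image_insert using n by (simp add: h)
    qed
    have "(\<lambda>i. {h (Rim i), h (Rim (i mod (n-1) + 1))}) ` {1..n-3} = (\<lambda>i. {PathV i, PathV (i+1)}) ` {1..n-3}"
      using n by (intro image_cong) (auto simp: h)
    moreover have "{h (Rim (Suc k)), h (Rim (Suc k mod (n-1) + 1))} = {ConnY, PathV (n-2)}"
      using n by (auto simp: h)
    moreover have "{h (Rim (Suc (Suc k))), h (Rim (Suc (Suc k) mod (n-1) + 1))} = {ConnY, PathV 1}"
      using n by (auto simp: h)
    ultimately have "(\<lambda>i. {h (Rim i), h (Rim (i mod (n-1) + 1))}) ` {1..n-1} =
      {{ConnY, PathV 1}, {ConnY, PathV (n-2)}} \<union> (\<lambda>i. {PathV i, PathV (i+1)}) ` {1..n-3}"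
      by (simp only: set2 image_insert Un_insert_left Un_empty_left)
    then show ?thesis
      unfolding E edges_H_graph image_Un image_image image_insert image_empty using spokes by auto
  qed
  ultimately show ?thesis by (auto simp: isomorphic_def map_graph_def)
qed

lemma wheel_edges_sub: "4 \<le> n \<Longrightarrow> \<Union> (edges (wheel n)) \<subseteq> verts (wheel n)"
proof -
  assume n: "4 \<le> n"
  have "i mod (n - 1) + 1 \<in> {1..n-1}" for i using n mod_less_divisor[of "n - 1" i]
    by (simp add: Suc_le_eq)
  then show ?thesis by (auto simp: wheel_def)
qed

lemma isomorphic_wheel_iff:
  assumes G: "simple_graph G"
  shows "(\<exists>n\<ge>4. isomorphic G (wheel n)) \<longleftrightarrow> (\<exists>\<phi> n. wheel_embedding \<phi> n G)"
proof -
  let ?W = "\<lambda>n. Graph (verts (H_graph n)) (insert {ConnX, ConnY} (edges (H_graph n)))"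
  have sub: "\<Union> (edges (?W n)) \<subseteq> verts (?W n)" if "4 \<le> n" for n
    using H_graph_edges_sub[OF that] by (auto simp: verts_H_graph)
  have emb: "isomorphic (?W n) G \<longleftrightarrow> (\<exists>\<phi>. wheel_embedding \<phi> n G)" if "4 \<le> n" for n
  proof -
    have "map_graph \<phi> (?W n) = G \<longleftrightarrow> verts G = \<phi> ` verts (H_graph n) \<and>
      edges G = insert {\<phi> ConnX, \<phi> ConnY} ((`) \<phi> ` edges (H_graph n))" for \<phi>
      by (cases G) (auto simp: map_graph_def)
    then show ?thesis using that by (simp add: isomorphic_def wheel_embedding_def)
  qed
  have "isomorphic G (wheel n) \<longleftrightarrow> isomorphic (?W n) G" if n: "4 \<le> n" for n
  proof
    assume "isomorphic G (wheel n)"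
    then have "isomorphic G (?W n)" using wheel_isomorphic_H_graph[OF n] isomorphic_trans by blast
    then show "isomorphic (?W n) G" using isomorphic_sym simple_graph_edges_sub[OF G] by blast
  next
    assume "isomorphic (?W n) G"
    then have "isomorphic (wheel n) G" using wheel_isomorphic_H_graph[OF n] isomorphic_trans by blast
    then show "isomorphic G (wheel n)" using isomorphic_sym wheel_edges_sub[OF n] by blast
  qed
  then show ?thesis using emb by (metis wheel_embedding_def)
qed

text \<open>Here g is the composed identification: it fixes the first copy and sends
  \<open>ConnX\<close> and \<open>ConnY\<close> of the second to x and y of the first. With x and y
  variable, both gluings are treated at once.\<close>

lemma isomorphic_glue_iff:
  fixes g :: "H_vertex + H_vertex \<Rightarrow> H_vertex + H_vertex"
  assumes G: "simple_graph G" and ij: "4 \<le> i" "4 \<le> j"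
    and g: "\<And>a. g (Inl a) = Inl a" "\<And>k. g (Inr (PathV k)) = Inr (PathV k)"
      "g (Inr ConnX) = Inl x" "g (Inr ConnY) = Inl y"
    and xy: "{x, y} = {ConnX, ConnY}"
  shows "isomorphic G (map_graph g (disjoint_union (H_graph i) (H_graph j))) \<longleftrightarrow>
    (\<exists>\<phi> \<psi>. glued \<phi> \<psi> i j G \<and> \<phi> x = \<psi> ConnX \<and> \<phi> y = \<psi> ConnY)" (is "isomorphic G (map_graph g ?D) \<longleftrightarrow> ?R")
proof -
  have VD: "verts ?D = Inl ` verts (H_graph i) \<union> Inr ` verts (H_graph j)"
    and ED: "edges ?D = (`) Inl ` edges (H_graph i) \<union> (`) Inr ` edges (H_graph j)"
    by (auto simp: disjoint_union_def)
  have gV: "g ` verts ?D = Inl ` verts (H_graph i) \<union> Inr ` PathV ` {1..j-2}"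
  proof -
    have "g ` Inr ` verts (H_graph j) = Inl ` {x, y} \<union> Inr ` PathV ` {1..j-2}"
      unfolding verts_H_graph image_Un image_image image_insert image_empty g by simp
    moreover have "g ` Inl ` verts (H_graph i) = Inl ` verts (H_graph i)" by (simp add: image_image g)
    moreover have "(Inl ` {x, y} :: (H_vertex + H_vertex) set) \<subseteq> Inl ` verts (H_graph i)"
      using xy by (intro image_mono) (simp add: verts_H_graph)
    ultimately show ?thesis by (simp only: VD image_Un Un_assoc[symmetric] Un_absorb2)
  qed
  have Dsub: "\<Union> (edges ?D) \<subseteq> verts ?D"
    unfolding VD ED using H_graph_edges_sub ij by blast
  have xney: "x \<noteq> y" using xy by (auto simp: doubleton_eq_iff)
  show ?thesis
  proof
    assume "isomorphic G (map_graph g ?D)"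
    then have "isomorphic (map_graph g ?D) G" using isomorphic_sym simple_graph_edges_sub[OF G] by blast
    then obtain f where f: "inj_on f (g ` verts ?D)" "map_graph f (map_graph g ?D) = G"
      by (auto simp: isomorphic_def map_graph_sel)
    define \<phi> where "\<phi> = f \<circ> Inl"
    \<comment> \<open>Going through g puts the connectors of the second copy on those of the
      first.\<close>
    define \<psi> where "\<psi> = f \<circ> g \<circ> Inr"
    have fL: "inj_on f (Inl ` verts (H_graph i))" using f(1) gV by (auto intro: inj_on_subset)
    have inj\<phi>: "inj_on \<phi> (verts (H_graph i))"
      unfolding \<phi>_def using fL by (intro comp_inj_on) auto
    have "inj_on (g \<circ> Inr) (verts (H_graph j))"
    proof (rule inj_onI)
      fix a b assume "(g \<circ> Inr) a = (g \<circ> Inr) b"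
      then show "a = b" using xney by (cases a; cases b) (auto simp: g)
    qed
    moreover have "inj_on f ((g \<circ> Inr) ` verts (H_graph j))"
      using f(1) by (rule inj_on_subset) (auto simp: VD)
    ultimately have inj\<psi>: "inj_on \<psi> (verts (H_graph j))"
      unfolding \<psi>_def comp_assoc by (rule comp_inj_on)
    have GG: "G = map_graph (f \<circ> g) ?D" using f(2) by (simp add: map_graph_comp)
    have conn: "\<phi> ` {ConnX, ConnY} = \<psi> ` {ConnX, ConnY}"
    proof -
      have "\<psi> ` {ConnX, ConnY} = \<phi> ` {x, y}" by (simp add: \<phi>_def \<psi>_def g)
      then show ?thesis by (simp only: xy)
    qed
    have "\<phi> ` verts (H_graph i) = f ` Inl ` verts (H_graph i)" by (simp add: \<phi>_def image_comp)
    moreover have "\<psi> ` verts (H_graph j) = f ` (Inl ` {x, y} \<union> Inr ` PathV ` {1..j-2})"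
      unfolding verts_H_graph image_Un image_image image_insert image_empty \<psi>_def by (simp add: g image_image)
    moreover have "f ` Inl ` verts (H_graph i) \<inter> f ` (Inl ` {x, y} \<union> Inr ` PathV ` {1..j-2}) =
      f ` (Inl ` verts (H_graph i) \<inter> (Inl ` {x, y} \<union> Inr ` PathV ` {1..j-2}))"
      using f(1) gV xy by (intro inj_on_image_Int[symmetric, of f "g ` verts ?D"]) (auto simp: verts_H_graph)
    moreover have "Inl ` verts (H_graph i) \<inter> (Inl ` {x, y} \<union> Inr ` PathV ` {1..j-2}) = Inl ` {ConnX, ConnY}"
      unfolding xy by (auto simp: verts_H_graph)
    ultimately have int: "\<phi> ` verts (H_graph i) \<inter> \<psi> ` verts (H_graph j) = \<phi> ` {ConnX, ConnY}"
      by (simp add: \<phi>_def)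
    have "verts G = \<phi> ` verts (H_graph i) \<union> \<psi> ` verts (H_graph j)"
      unfolding GG map_graph_sel VD image_Un image_image \<phi>_def \<psi>_def by (simp add: g image_image)
    moreover have "edges G = (`) \<phi> ` edges (H_graph i) \<union> (`) \<psi> ` edges (H_graph j)"
      unfolding GG map_graph_sel ED image_Un image_image \<phi>_def \<psi>_def by (simp add: g image_image)
    ultimately have "glued \<phi> \<psi> i j G"
      using ij inj\<phi> inj\<psi> conn int by (simp add: glued_def)
    moreover have "\<phi> x = \<psi> ConnX" "\<phi> y = \<psi> ConnY" by (simp_all add: \<phi>_def \<psi>_def g)
    ultimately show ?R by blast
  next
    assume ?R
    then obtain \<phi> \<psi> where gl: "glued \<phi> \<psi> i j G" and ends: "\<phi> x = \<psi> ConnX" "\<phi> y = \<psi> ConnY" by blast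
    \<comment> \<open>The two embeddings combine to a map h on the disjoint union. It agrees on
      vertices that g identifies, so it maps the glued graph onto G.\<close>
    define h where "h = case_sum \<phi> \<psi>"
    have hg: "h (g v) = h v" for v
    proof (cases v)
      case (Inr b)
      then show ?thesis by (cases b) (auto simp: h_def g ends)
    qed (simp add: g)
    have inj: "inj_on \<phi> (verts (H_graph i))" "inj_on \<psi> (verts (H_graph j))"
      and V: "verts G = \<phi> ` verts (H_graph i) \<union> \<psi> ` verts (H_graph j)"
      and E: "edges G = (`) \<phi> ` edges (H_graph i) \<union> (`) \<psi> ` edges (H_graph j)"
      using gl by (simp_all add: glued_def)
    have "map_graph h (map_graph g ?D) = map_graph h ?D"
      by (simp add: map_graph_comp comp_def hg)
    also have "\<dots> = Graph (verts G) (edges G)"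
      unfolding map_graph_def VD ED V E image_Un image_image by (simp add: h_def image_image)
    also have "\<dots> = G" by simp
    finally have "map_graph h (map_graph g ?D) = G" .
    moreover have "inj_on h (verts (map_graph g ?D))"
    proof -
      have PV: "PathV ` {1..j-2} \<subseteq> verts (H_graph j)" by (auto simp: verts_H_graph)
      have 1: "inj_on h (Inl ` verts (H_graph i))" using inj(1) by (auto simp: inj_on_def h_def)
      have 2: "inj_on h (Inr ` PathV ` {1..j-2})"
        using inj_on_subset[OF inj(2) PV] by (auto simp: inj_on_def h_def)
      have "\<phi> a \<noteq> \<psi> (PathV k)" if "a \<in> verts (H_graph i)" "k \<in> {1..j-2}" for a k
        using glued_disjoint[OF glued_sym[OF gl] that(2)] that(1) by (metis imageI)
      then have 3: "h ` (Inl ` verts (H_graph i) - Inr ` PathV ` {1..j-2}) \<inter>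
          h ` (Inr ` PathV ` {1..j-2} - Inl ` verts (H_graph i)) = {}"
        by (auto simp: h_def)
      show ?thesis unfolding map_graph_sel gV using 1 2 3 by (simp add: inj_on_Un)
    qed
    ultimately have "isomorphic (map_graph g ?D) G" by (auto simp: isomorphic_def)
    then show "isomorphic G (map_graph g ?D)"
      by (rule isomorphic_sym) (rule map_graph_edges_sub[OF Dsub])
  qed
qed

lemma isomorphic_glue_family_iff:
  assumes G: "simple_graph G"
  shows "(\<exists>i\<ge>4. \<exists>j\<ge>4. isomorphic G (glue_straight i j) \<or> isomorphic G (glue_crossed i j)) \<longleftrightarrow>
    (\<exists>\<phi> \<psi> i j. glued \<phi> \<psi> i j G)"
proof -
  have s: "isomorphic G (glue_straight i j) \<longleftrightarrow>
      (\<exists>\<phi> \<psi>. glued \<phi> \<psi> i j G \<and> \<phi> ConnX = \<psi> ConnX \<and> \<phi> ConnY = \<psi> ConnY)"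
    if "4 \<le> i" "4 \<le> j" for i j
    unfolding glue_straight_def identify_def map_graph_comp
    by (rule isomorphic_glue_iff[OF G that]) auto
  have c: "isomorphic G (glue_crossed i j) \<longleftrightarrow>
      (\<exists>\<phi> \<psi>. glued \<phi> \<psi> i j G \<and> \<phi> ConnY = \<psi> ConnX \<and> \<phi> ConnX = \<psi> ConnY)"
    if "4 \<le> i" "4 \<le> j" for i j
    unfolding glue_crossed_def identify_def map_graph_comp
    by (rule isomorphic_glue_iff[OF G that]) auto
  have "4 \<le> i \<and> 4 \<le> j \<and> (isomorphic G (glue_straight i j) \<or> isomorphic G (glue_crossed i j))"
    if "glued \<phi> \<psi> i j G" for \<phi> \<psi> i j
  proof -
    have ij: "4 \<le> i" "4 \<le> j" and "\<phi> ` {ConnX, ConnY} = \<psi> ` {ConnX, ConnY}"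
      using that by (simp_all add: glued_def)
    then have "\<phi> ConnX = \<psi> ConnX \<and> \<phi> ConnY = \<psi> ConnY \<or> \<phi> ConnX = \<psi> ConnY \<and> \<phi> ConnY = \<psi> ConnX"
      by (simp add: doubleton_eq_iff)
    then show ?thesis using s[OF ij] c[OF ij] that ij by blast
  qed
  moreover have "\<exists>\<phi> \<psi>. glued \<phi> \<psi> i j G"
    if "4 \<le> i" "4 \<le> j" "isomorphic G (glue_straight i j) \<or> isomorphic G (glue_crossed i j)" for i j
    using that(3) s[OF that(1,2)] c[OF that(1,2)] by blast
  ultimately show ?thesis by meson
qed

section \<open>Tight sets\<close>

locale critical = sgraph +
  assumes extremal: "G \<in> extremal_family"
begin

section \<open>Density and degrees in an extremal graph\<close>

lemma card_V: "2 \<le> card V" and card_E: "card E = 2 * card V - 2"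
  using extremal by (auto simp: extremal_family_def)

lemma no_proper_subgraph:
  assumes "subgraph H G" "H \<noteq> G" "verts H \<noteq> {}"
  shows "\<exists>v\<in>verts H. degree H v \<le> 2"
proof (rule ccontr)
  assume "\<not> ?thesis"
  then have "\<forall>v\<in>verts H. 3 \<le> degree H v" by force
  moreover have "finite (verts H)" using assms(1) by (simp add: subgraph_def simple_graph_def)
  ultimately have "3 \<le> min_degree H" using assms(3) by (simp add: min_degree_def)
  then show False using assms extremal by (auto simp: extremal_family_def)
qed

text \<open>Extremality in the form used for vertex sets: the subgraph induced on S is proper
  because it misses a vertex.\<close>

lemma no_core:
  assumes "S \<subset> V" "S \<noteq> {}"
  shows "\<exists>v\<in>S. deg_in S v \<le> 2"
proof -
  let ?H = "Graph S (edges_in S)"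
  have "subgraph ?H G"
    using assms simple finite_sub[of S] by (auto simp: subgraph_def simple_graph_def edges_in_def)
  moreover have "?H \<noteq> G" using assms(1) by (metis graph.sel(1) psubset_eq)
  ultimately obtain v where "v \<in> S" "degree ?H v \<le> 2"
    using no_proper_subgraph[of ?H] assms by auto
  then show ?thesis using card_star[of v S] by (auto simp: degree_def)
qed

text \<open>A denser proper set would contain a core by \<open>exists_core\<close>, against
  \<open>no_core\<close>.\<close>

lemma esize_bound:
  assumes "S \<subset> V" "2 \<le> card S"
  shows "esize S + 3 \<le> 2 * card S"
proof (rule ccontr)
  assume "\<not> ?thesis"
  then have "2 * card S \<le> esize S + 2" by simp
  then obtain T where T: "T \<subseteq> S" "T \<noteq> {}" "\<forall>v\<in>T. 3 \<le> deg_in T v"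
    using exists_core[of S] assms by auto
  then show False using no_core[of T] assms by fastforce
qed

text \<open>V itself has enough edges for \<open>exists_core\<close>, and by \<open>no_core\<close>
  the core found can only be V.\<close>

lemma min_deg: "v \<in> V \<Longrightarrow> 3 \<le> deg_in V v"
proof -
  assume v: "v \<in> V"
  have "2 * card V \<le> esize V + 2" using card_V card_E esize_V by linarith
  then obtain T where T: "T \<subseteq> V" "T \<noteq> {}" "\<forall>v\<in>T. 3 \<le> deg_in T v"
    using exists_core[OF order_refl card_V] by blast
  then have "T = V" using no_core[of T] by fastforce
  then show ?thesis using T v by auto
qed

text \<open>After deletion of the edge some vertex has degree at most 2. It had degree at least 3
  before, so it is an end of the edge and had degree exactly 3.\<close>

lemma edge_degree3:
  assumes "{u, v} \<in> E"
  shows "deg_in V u = 3 \<or> deg_in V v = 3"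
proof -
  let ?H = "Graph V (E - {{u, v}})"
  have "subgraph ?H G" using simple by (auto simp: subgraph_def simple_graph_def)
  moreover have "?H \<noteq> G" using assms by (metis Diff_iff graph.sel(2) singletonI)
  moreover have "V \<noteq> {}" using card_V by auto
  ultimately obtain w where w: "w \<in> V" "degree ?H w \<le> 2" using no_proper_subgraph[of ?H] by auto
  let ?N = "{e \<in> E. w \<in> e}"
  have dw: "card ?N \<ge> 3" using min_deg[OF w(1)] deg_in_V[OF w(1)] by (simp add: degree_def)
  have "{e \<in> E - {{u, v}}. w \<in> e} = ?N - {{u, v}}" by blast
  then have le: "card (?N - {{u, v}}) \<le> 2" using w(2) by (simp add: degree_def)
  have "{u, v} \<in> ?N"
  proof (rule ccontr)
    assume "{u, v} \<notin> ?N"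
    then have "?N - {{u, v}} = ?N" by blast
    then show False using le dw by simp
  qed
  then have "w = u \<or> w = v" "card (?N - {{u, v}}) = card ?N - 1" by auto
  then have "card ?N = 3" using le dw by simp
  then have "deg_in V w = 3" using deg_in_V[OF w(1)] by (simp add: degree_def)
  then show ?thesis using \<open>w = u \<or> w = v\<close> by auto
qed

definition B where "B = {v \<in> V. deg_in V v \<noteq> 3}"

lemma B_sub: "B \<subseteq> V" by (auto simp: B_def)

lemma finite_B: "finite B" using B_sub finite_sub by blast

lemma deg_B: "b \<in> B \<Longrightarrow> 4 \<le> deg_in V b"
  using min_deg[of b] by (auto simp: B_def)

lemma deg_A: "v \<in> V \<Longrightarrow> v \<notin> B \<Longrightarrow> deg_in V v = 3"
  by (auto simp: B_def)

lemma B_indep: "b \<in> B \<Longrightarrow> b' \<in> B \<Longrightarrow> {b, b'} \<notin> E"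
  using edge_degree3 by (auto simp: B_def)

section \<open>Deleting vertices from tight sets\<close>

definition tight where "tight S \<longleftrightarrow> S \<subset> V \<and> 2 \<le> card S \<and> esize S + 3 = 2 * card S"

text \<open>A vertex of G outside \<open>B\<close> has degree 3 in G, so for S within V the
  condition says that S contains all neighbours of such a vertex.\<close>

definition closed where "closed S \<longleftrightarrow> (\<forall>v\<in>S - B. 3 \<le> deg_in S v)"

text \<open>The deletion lowers \<open>2 * card S\<close> by 2 and \<open>esize S\<close> by at most
  2, while \<open>esize_bound\<close> allows no less. With \<open>3 \<le> card S\<close> two
  vertices remain, as this bound requires.\<close>

lemma tight_remove:
  assumes "tight S" "v \<in> S" "deg_in S v \<le> 2" "3 \<le> card S"
  shows "tight (S - {v})" "deg_in S v = 2"
proof -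
  have S: "S \<subset> V" "esize S + 3 = 2 * card S" using assms(1) by (auto simp: tight_def)
  then have fin: "finite S" using finite_sub by blast
  have c: "card (S - {v}) = card S - 1" using assms(2) fin by simp
  have e: "esize S = esize (S - {v}) + deg_in S v" using esize_remove assms(2) by blast
  have "S - {v} \<subset> V" using S by auto
  then have b: "esize (S - {v}) + 3 \<le> 2 * card (S - {v})" using esize_bound[of "S - {v}"] c assms(4) by simp
  then show d: "deg_in S v = 2" using e c S(2) assms(3,4) by linarith
  show "tight (S - {v})" using d e c S assms(4) \<open>S - {v} \<subset> V\<close> by (auto simp: tight_def)
qed

text \<open>A smallest tight set between C and S will do: by \<open>tight_remove\<close>, a vertex
  outside C of degree at most 2 could be deleted. The size of C ensures that such a set has at least
  three vertices.\<close>

lemma shrink: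
  assumes "tight S" "C \<subseteq> S" "2 \<le> card C"
  obtains S' where "tight S'" "C \<subseteq> S'" "S' \<subseteq> S" "\<And>v. v \<in> S' - C \<Longrightarrow> 3 \<le> deg_in S' v"
proof -
  let ?P = "\<lambda>T. tight T \<and> C \<subseteq> T \<and> T \<subseteq> S"
  have finS: "finite S" using assms(1) finite_sub by (auto simp: tight_def)
  have "\<exists>T. ?P T \<and> (\<forall>U. ?P U \<longrightarrow> card T \<le> card U)"
    using assms by (intro ex_has_least_nat[of ?P S card]) auto
  then obtain T where T: "?P T" and minT: "\<And>U. ?P U \<Longrightarrow> card T \<le> card U" by auto
  have finT: "finite T" using T finS finite_subset by blast
  have "3 \<le> deg_in T v" if v: "v \<in> T - C" for v
  proof (rule ccontr)
    assume "\<not> 3 \<le> deg_in T v"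
    moreover have "3 \<le> card T"
    proof -
      have "C \<subset> T" using v T by auto
      then have "card C < card T" using finT psubset_card_mono by blast
      then show ?thesis using assms(3) by simp
    qed
    ultimately have "tight (T - {v})" using tight_remove[of T v] T v by auto
    then have "?P (T - {v})" using T v by auto
    then have "card T \<le> card (T - {v})" by (rule minT)
    moreover have "card (T - {v}) < card T" using v finT by (meson DiffD1 card_Diff1_less)
    ultimately show False by simp
  qed
  then show ?thesis using that[of T] T by blast
qed

text \<open>A tight set of two vertices spans an edge, but \<open>B\<close> is independent.\<close>

lemma tight_card:
  assumes "tight S" "2 \<le> card (S \<inter> B)"
  shows "3 \<le> card S"
proof (rule ccontr)
  assume "\<not> 3 \<le> card S"
  then have c2: "card S = 2" using assms(1) by (auto simp: tight_def)
  have fin: "finite S" using assms(1) finite_sub by (auto simp: tight_def)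
  then have "S \<inter> B = S" using c2 assms(2) by (intro card_seteq) auto
  then have "S \<subseteq> B" by auto
  obtain a b where ab: "S = {a, b}" using c2 by (meson card_2_iff)
  have "nbrs S a = {}" using B_indep \<open>S \<subseteq> B\<close> ab by (auto simp: nbrs_def)
  then have "deg_in S a = 0" by (simp add: deg_in_def)
  moreover have "a \<noteq> b" using ab c2 by auto
  then have "S - {a} = {b}" using ab by auto
  ultimately have "esize S = 0" using esize_remove[of a S] esize_single[of b] ab by simp
  then show False using assms(1) c2 by (simp add: tight_def)
qed

text \<open>Being proper, S has a vertex of degree at most 2 in S; closedness puts it into
  \<open>B\<close>, and tightness makes the degree exactly 2.\<close>

lemma closed_degree2:
  assumes "tight S" "closed S" "2 \<le> card (S \<inter> B)"
  obtains b where "b \<in> S \<inter> B" "deg_in S b = 2" "tight (S - {b})"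
proof -
  have c: "3 \<le> card S" using tight_card assms by blast
  then have "S \<noteq> {}" by auto
  moreover have "S \<subset> V" using assms(1) by (simp add: tight_def)
  ultimately obtain b where b: "b \<in> S" "deg_in S b \<le> 2" using no_core by blast
  have "\<not> 3 \<le> deg_in S b" using b(2) by simp
  then have "b \<in> B" using assms(2) b(1) unfolding closed_def by blast
  then show ?thesis using that[of b] b tight_remove[OF assms(1) b c] by blast
qed

text \<open>This is \<open>shrink\<close> with \<open>S \<inter> B\<close> protected: every vertex
  left outside \<open>B\<close> has degree at least 3.\<close>

lemma shrink_closed:
  assumes "tight S" "2 \<le> card (S \<inter> B)"
  obtains S' where "tight S'" "closed S'" "S' \<subseteq> S" "S' \<inter> B = S \<inter> B"
proof -
  obtain S' where S': "tight S'" "S \<inter> B \<subseteq> S'" "S' \<subseteq> S"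
    "\<And>v. v \<in> S' - S \<inter> B \<Longrightarrow> 3 \<le> deg_in S' v"
    using shrink[of S "S \<inter> B"] assms by blast
  then show ?thesis using that[of S'] by (auto simp: closed_def)
qed

text \<open>Deleting the vertex z of degree 2 may spoil closedness; shrinking restores it and
  removes no further vertex of \<open>B\<close>.\<close>

lemma descend:
  assumes "tight S" "closed S" "3 \<le> card (S \<inter> B)"
  obtains z S' where "z \<in> S \<inter> B" "deg_in S z = 2" "tight S'" "closed S'" "S' \<subseteq> S - {z}"
    "S' \<inter> B = S \<inter> B - {z}"
proof -
  obtain z where z: "z \<in> S \<inter> B" "deg_in S z = 2" "tight (S - {z})"
    using closed_degree2[OF assms(1,2)] assms(3) by auto
  have "(S - {z}) \<inter> B = S \<inter> B - {z}" by auto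
  moreover have "finite (S \<inter> B)" using finite_B by blast
  ultimately have "2 \<le> card ((S - {z}) \<inter> B)" using assms(3) z(1) by simp
  then obtain S' where "tight S'" "closed S'" "S' \<subseteq> S - {z}" "S' \<inter> B = (S - {z}) \<inter> B"
    using shrink_closed[OF z(3)] by blast
  then show ?thesis using that[of z S'] z \<open>(S - {z}) \<inter> B = S \<inter> B - {z}\<close> by auto
qed

lemma degree_sum_V: "(\<Sum>v\<in>V. deg_in V v) + 4 = 4 * card V"
  using handshake[OF finite_V] esize_V card_E card_V by simp

text \<open>The average degree is less than 4.\<close>

lemma exists_degree3: obtains v where "v \<in> V" "deg_in V v = 3"
proof -
  have "\<exists>v\<in>V. deg_in V v = 3"
  proof (rule ccontr)
    assume "\<not> ?thesis"
    then have "\<And>v. v \<in> V \<Longrightarrow> 4 \<le> deg_in V v" using min_deg by fastforce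
    then have "(\<Sum>v\<in>V. 4) \<le> (\<Sum>v\<in>V. deg_in V v)" by (rule sum_mono)
    then show False using degree_sum_V by simp
  qed
  then show ?thesis using that by blast
qed

text \<open>The count is (2|V| - 2) - 3 = 2(|V| - 1) - 3.\<close>

lemma tight_start:
  assumes "v \<in> V" "deg_in V v = 3"
  shows "tight (V - {v})"
proof -
  have "card V > deg_in V v" using deg_in_le[OF finite_V assms(1)] card_V by linarith
  moreover have "card E = esize (V - {v}) + 3" using esize_remove[OF assms(1)] assms(2) esize_V by simp
  ultimately show ?thesis using assms finite_V card_E by (auto simp: tight_def)
qed

text \<open>Downward induction on k: deleting a vertex of degree 3 and shrinking gives a set that
  contains all of \<open>B\<close>, and each use of \<open>descend\<close> removes one element of
  \<open>B\<close>.\<close>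

lemma exists_closed:
  assumes "2 \<le> k" "k \<le> card B"
  obtains S where "tight S" "closed S" "card (S \<inter> B) = k"
proof -
  have "\<exists>S. tight S \<and> closed S \<and> card (S \<inter> B) = k"
    using assms(2,1)
  proof (induction rule: inc_induct)
    case base
    obtain v where v: "v \<in> V" "deg_in V v = 3" using exists_degree3 .
    have "(V - {v}) \<inter> B = B" using v B_sub by (auto simp: B_def)
    then show ?case using shrink_closed[OF tight_start[OF v]] base by metis
  next
    case (step n)
    then obtain S where S: "tight S" "closed S" "card (S \<inter> B) = Suc n" by auto
    obtain z S' where "z \<in> S \<inter> B" "tight S'" "closed S'" "S' \<inter> B = S \<inter> B - {z}"
      using descend[OF S(1,2)] S(3) step.prems by (metis Suc_le_mono numeral_3_eq_3 numeral_2_eq_2)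
    moreover have "finite (S \<inter> B)" using finite_B by blast
    ultimately show ?case using S(3) by (intro exI[of _ S']) simp
  qed
  then show ?thesis using that by blast
qed

lemma closed_nbrs:
  assumes "closed S" "S \<subseteq> V" "v \<in> S - B" "{v, w} \<in> E"
  shows "w \<in> S"
proof -
  have "card (nbrs V v) \<le> card (nbrs S v)"
    using assms deg_A[of v] by (auto simp: closed_def deg_in_def)
  then have "nbrs S v = nbrs V v"
    using nbrs_mono[OF assms(2)] finite_nbrs[of V] by (meson card_seteq order_refl)
  moreover have "w \<in> nbrs V v" using assms(4) edge_in_V by (auto simp: nbrs_def)
  ultimately show ?thesis by (auto simp: nbrs_def)
qed

lemma closed_deg:
  assumes "closed S" "S \<subseteq> V" "v \<in> S - B"
  shows "deg_in S v = 3"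
proof -
  have "deg_in S v \<le> deg_in V v" using assms(2) finite_V by (rule deg_in_mono)
  moreover have "deg_in V v = 3" using assms deg_A by blast
  moreover have "3 \<le> deg_in S v" using assms by (auto simp: closed_def)
  ultimately show ?thesis by simp
qed

text \<open>Otherwise \<open>insert x D\<close>, which is proper as it misses y, would have all
  degrees at least 3: the vertices of D gain the neighbour x, and x has at least three neighbours in
  D. This provides the hypothesis \<open>sparse\<close> of \<open>H_graph_structure\<close>.\<close>

lemma hub_sparse:
  assumes "x \<in> V" "y \<in> V" "x \<noteq> y" "D \<subseteq> V - {x, y}" "D \<noteq> {}"
    and hub: "\<And>v. v \<in> D \<Longrightarrow> {x, v} \<in> E"
  shows "\<exists>v\<in>D. deg_in D v \<le> 1"
proof (rule ccontr)
  assume "\<not> ?thesis"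
  then have two: "\<And>v. v \<in> D \<Longrightarrow> 2 \<le> deg_in D v" by force
  have finD: "finite D" using assms(4) finite_sub by blast
  obtain d where d: "d \<in> D" using assms(5) by blast
  have "deg_in D d \<le> card D - 1" using deg_in_le finD d by blast
  then have D3: "3 \<le> card D" using two[OF d] by linarith
  have xD: "x \<notin> D" using assms(4) by auto
  have "y \<notin> insert x D" using assms(3,4) by auto
  then have "insert x D \<subset> V" using assms(1,2,4) by blast
  then obtain v where v: "v \<in> insert x D" "deg_in (insert x D) v \<le> 2"
    using no_core[of "insert x D"] by blast
  show False
  proof (cases "v = x")
    case True
    have "D \<subseteq> nbrs (insert x D) x" using hub by (auto simp: nbrs_def)
    then have "card D \<le> deg_in (insert x D) x"
      unfolding deg_in_def using finite_nbrs' finD by (intro card_mono) auto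
    then show False using v(2) True D3 by simp
  next
    case False
    then have vD: "v \<in> D" using v by simp
    have "x \<in> nbrs V v" using hub[OF vD] assms(1) by (simp add: nbrs_def insert_commute)
    then have "deg_in (insert x D) v = deg_in D v + 1"
      using deg_in_insert[OF finD xD False] by simp
    then show False using v(2) two[OF vD] by simp
  qed
qed

end

section \<open>Classification by the number of vertices of degree at least 4\<close>

context critical
begin

text \<open>As \<open>B\<close> is independent, x and y have neighbours only in L = S - {x, y},
  whose vertices have degree 3. The degree sum 2(2|S| - 3) = 4|L| + 2, less 3|L| for L and 2 for y,
  leaves |L| for x. The two neighbours of y in L give |S| \<ge> 4.\<close>

lemma closed_tight_hub:
  assumes "tight S" "closed S" "S \<inter> B = {x, y}" "x \<noteq> y" "deg_in S y = 2"
  shows "nbrs S x = S - {x, y}" and "4 \<le> card S"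
proof -
  have S: "S \<subset> V" "esize S + 3 = 2 * card S" using assms(1) by (auto simp: tight_def)
  have fin: "finite S" using S finite_sub by blast
  define L where "L = S - {x, y}"
  have xyS: "x \<in> S" "y \<in> S" "x \<in> B" "y \<in> B" using assms(3) by auto
  have LB: "L = S - B" using assms(3) by (auto simp: L_def)
  have S_eq: "S = insert x (insert y L)" using xyS by (auto simp: L_def)
  have finL: "finite L" and xL: "x \<notin> L" "y \<notin> L" using fin by (auto simp: L_def)
  have cS: "card S = card L + 2" unfolding S_eq using finL xL assms(4) by simp
  have nL: "nbrs S b \<subseteq> L" if "b \<in> B" "b \<in> S" for b
    using B_indep that by (auto simp: nbrs_def LB)
  have "(\<Sum>v\<in>S. deg_in S v) = deg_in S x + (deg_in S y + (\<Sum>v\<in>L. deg_in S v))"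
    by (subst S_eq) (use finL xL assms(4) in simp)
  moreover have "(\<Sum>v\<in>L. deg_in S v) = (\<Sum>v\<in>L. 3)"
    using closed_deg[OF assms(2)] S LB by (intro sum.cong) auto
  moreover have "(\<Sum>v\<in>S. deg_in S v) = 2 * esize S" using handshake fin S by blast
  ultimately have "deg_in S x = card L" using assms(5) S(2) cS by simp
  then show "nbrs S x = S - {x, y}"
    using card_subset_eq[OF finL nL] xyS by (auto simp: deg_in_def L_def)
  have "deg_in S y \<le> card L" unfolding deg_in_def using nL xyS finL by (intro card_mono) auto
  then show "4 \<le> card S" using cS assms(5) by simp
qed

lemma two_connectors:
  assumes "tight S" "closed S" "card (S \<inter> B) = 2"
  obtains x y where "S \<inter> B = {x, y}" "x \<noteq> y" "deg_in S y = 2"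
proof -
  obtain y where y: "y \<in> S \<inter> B" "deg_in S y = 2" using closed_degree2[OF assms(1,2)] assms(3) by (metis order_refl)
  then have "card (S \<inter> B - {y}) = 1" using assms(3) finite_B by simp
  then obtain x where "S \<inter> B - {y} = {x}" by (meson card_1_singletonE)
  then have "S \<inter> B = {x, y}" "x \<noteq> y" using y by auto
  then show ?thesis using that y by blast
qed

text \<open>Of the two vertices in \<open>S \<inter> B\<close>, one has degree 2 in S and the other
  is a hub by \<open>closed_tight_hub\<close>, as \<open>H_graph_structure\<close> requires. They
  are not adjacent, so no edge has to be set apart.\<close>

lemma closed_tight_H_graph:
  assumes "tight S" "closed S" "card (S \<inter> B) = 2"
  obtains \<phi> n where "4 \<le> n" "inj_on \<phi> (verts (H_graph n))" "\<phi> ` {ConnX, ConnY} = S \<inter> B"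
    "\<phi> ` verts (H_graph n) = S" "edges_in S = (`) \<phi> ` edges (H_graph n)"
proof -
  obtain x y where xy: "S \<inter> B = {x, y}" "x \<noteq> y" "deg_in S y = 2"
    using two_connectors[OF assms] .
  have hub: "nbrs S x = S - {x, y}" using closed_tight_hub[OF assms(1,2) xy] by blast
  have S: "S \<subset> V" using assms(1) by (auto simp: tight_def)
  have xyS: "x \<in> S" "y \<in> S" "x \<in> B" "y \<in> B" using xy(1) by auto
  have "{x, y} \<notin> E" using B_indep xyS by blast
  then have "nbrs (S - {x}) y = nbrs S y" by (auto simp: nbrs_def insert_commute)
  then have dy: "deg_in (S - {x}) y = 2" using xy(3) by (simp add: deg_in_def)
  have h: "{x, v} \<in> E" if "v \<in> S - {x, y}" for v
    using that unfolding hub[symmetric] by (simp add: nbrs_def)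
  have d3: "deg_in S v = 3" if "v \<in> S - {x, y}" for v
    using closed_deg[OF assms(2)] S xy(1) that by blast
  have sp: "\<exists>v\<in>D. deg_in D v \<le> 1" if D: "D \<subseteq> S - {x, y}" "D \<noteq> {}" for D
  proof (rule hub_sparse[of x y])
    show "D \<subseteq> V - {x, y}" using D S by blast
    show "\<And>v. v \<in> D \<Longrightarrow> {x, v} \<in> E" using D h by blast
  qed (use xyS xy S D in auto)
  obtain \<phi> n where \<phi>: "4 \<le> n" "inj_on \<phi> (verts (H_graph n))" "\<phi> ConnX = x" "\<phi> ConnY = y"
    "\<phi> ` verts (H_graph n) = S" "edges_in S - {{x, y}} = (`) \<phi> ` edges (H_graph n)"
    using H_graph_structure[OF psubset_imp_subset[OF S] xyS(1,2) xy(2) h d3 dy sp] .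
  moreover have "edges_in S - {{x, y}} = edges_in S"
    using \<open>{x, y} \<notin> E\<close> by (auto simp: edges_in_def)
  ultimately show ?thesis using that[of n \<phi>] xy(1) by simp
qed

section \<open>At most two vertices of degree at least 4\<close>

lemma card_B_le: "card B \<le> 2"
proof (rule ccontr)
  assume "\<not> card B \<le> 2"
  then obtain T where T: "tight T" "closed T" "card (T \<inter> B) = 3"
    using exists_closed[of 3] by auto
  obtain z U where z: "z \<in> T \<inter> B" "deg_in T z = 2" and U: "tight U" "closed U" "U \<subseteq> T - {z}"
    and UB: "U \<inter> B = T \<inter> B - {z}"
    using descend[OF T(1,2)] T(3) by auto
  have "card (U \<inter> B) = 2" using UB T(3) z(1) finite_B by simp
  then obtain x y where xy: "U \<inter> B = {x, y}" "x \<noteq> y" "deg_in U y = 2"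
    using two_connectors[OF U(1,2)] by blast
  have hub: "nbrs U x = U - {x, y}" and cU: "4 \<le> card U"
    using closed_tight_hub[OF U(1,2) xy] by auto
  have TV: "T \<subset> V" and eT: "esize T + 3 = 2 * card T" using T(1) by (auto simp: tight_def)
  have UV: "U \<subset> V" and eU: "esize U + 3 = 2 * card U" using U(1) by (auto simp: tight_def)
  have finT: "finite T" and finU: "finite U" using TV UV finite_sub by blast+
  have xyU: "x \<in> U" "y \<in> U" "x \<in> B" "y \<in> B" using xy(1) by auto
  define K where "K = T - U - {z}"
  have KB: "K \<inter> B = {}" using UB by (auto simp: K_def)
  \<comment> \<open>A neighbour of z in U would lie outside \<open>B\<close>, and closedness of U
    would put z into U.\<close>
  have zU: "{z, t} \<notin> E" if "t \<in> U" for t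
  proof
    assume e: "{z, t} \<in> E"
    then have "t \<notin> B" using B_indep z(1) by blast
    then have "z \<in> U" using closed_nbrs[of U t z] U UV that e by (auto simp: insert_commute)
    then show False using U(3) by blast
  qed
  \<comment> \<open>T is closed, so the neighbours of k lie in T. One in U must be x or y, since
    closedness of U would otherwise put k into U.\<close>
  have Knb: "t \<in> K \<union> {x, y, z}" if "k \<in> K" "{k, t} \<in> E" for k t
  proof -
    have "k \<in> T - B" "k \<notin> U" using that KB by (auto simp: K_def)
    then have "t \<in> T" using closed_nbrs[of T k t] T TV that by blast
    moreover have "t \<in> B" if "t \<in> U"
      using closed_nbrs[of U t k] U UV that \<open>k \<notin> U\<close> \<open>{k, t} \<in> E\<close> by (auto simp: insert_commute)
    ultimately show ?thesis using xy(1) by (auto simp: K_def)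
  qed
  obtain u w where uw: "nbrs T z = {u, w}" "u \<noteq> w"
    using z(2) unfolding deg_in_def by (meson card_2_iff)
  have "nbrs T z \<subseteq> K" using zU nbrs_sub[of T z] by (auto simp: nbrs_def K_def)
  then have uK: "u \<in> K" and wK: "w \<in> K" using uw by auto
  have KV: "K \<subseteq> V" using TV by (auto simp: K_def)
  have "deg_in V u = 3" using deg_A[of u] uK KB KV by blast
  then have "tight (V - {u})" using tight_start uK KV by blast
  moreover have "2 \<le> card (V - K)"
  proof -
    have "U \<subseteq> V - K" using UV by (auto simp: K_def)
    then have "card U \<le> card (V - K)" using finite_V by (meson card_mono finite_Diff)
    then show ?thesis using cU by simp
  qed
  moreover have "V - K \<subseteq> V - {u}" using uK by blast
  \<comment> \<open>Only vertices of K are deleted from \<open>V - {u}\<close>, and those of K that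
    stay have degree at least 3.\<close>
  ultimately obtain S where S: "tight S" "V - K \<subseteq> S" "S \<subseteq> V - {u}"
    and degK: "\<And>v. v \<in> S - (V - K) \<Longrightarrow> 3 \<le> deg_in S v"
    using shrink by blast
  have SV: "S \<subset> V" and eS: "esize S + 3 = 2 * card S" using S(1) by (auto simp: tight_def)
  have finS: "finite S" using SV finite_sub by blast
  have US: "U \<subseteq> S" using S(2) UV by (auto simp: K_def)
  have zS: "z \<in> S" using S(2) z(1) B_sub by (auto simp: K_def)
  define Q where "Q = S \<inter> T - {z}"
  have zQ: "z \<in> S \<inter> T" using zS z by auto
  have finQ: "finite (S \<inter> T)" using finS by auto
  have un: "S \<union> T = V" using S(2) SV TV by (auto simp: K_def)
  \<comment> \<open>Vertices of T - S lie in K and have no neighbour outside T, so the counts add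
    up. As S and T are tight and their union is V, the intersection is one edge short of
    tight.\<close>
  have "esize (S \<union> T) + esize (S \<inter> T) = esize S + esize T"
  proof (rule esize_Un)
    fix v t assume "v \<in> S - T" "t \<in> T - S"
    moreover then have "t \<in> K" using S(2) TV by blast
    ultimately show "{v, t} \<notin> E" using Knb[of t v] xyU U(3) z(1)
      by (auto simp: insert_commute K_def)
  qed
  moreover have "card (S \<union> T) + card (S \<inter> T) = card S + card T"
    using card_Un_Int[OF finS finT] by simp
  ultimately have eST: "esize (S \<inter> T) + 4 = 2 * card (S \<inter> T)"
    using un esize_V card_E card_V eS eT by simp
  have eQ: "esize (S \<inter> T) = esize Q + deg_in (S \<inter> T) z"
    unfolding Q_def using esize_remove zQ by blast
  have cQ: "card (S \<inter> T) = card Q + 1" using card.remove[OF finQ zQ] unfolding Q_def by linarith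
  have UQ: "U \<subseteq> Q" using US U(3) by (auto simp: Q_def)
  have "card U \<le> card Q" using UQ finQ by (intro card_mono) (auto simp: Q_def)
  \<comment> \<open>Since Q contains U, the bound applies to Q and forces z to have a neighbour in
    \<open>S \<inter> T\<close>. This can only be w, as u is deleted; hence w stays, and Q attains
    the bound.\<close>
  then have Qb: "esize Q + 3 \<le> 2 * card Q"
    using cU SV by (intro esize_bound) (auto simp: Q_def)
  have nz: "nbrs (S \<inter> T) z \<subseteq> {w}"
    using uw(1) S(3) by (auto simp: nbrs_def)
  then have "deg_in (S \<inter> T) z \<le> 1"
    unfolding deg_in_def using card_mono[OF _ nz] by simp
  moreover have "1 \<le> deg_in (S \<inter> T) z" using Qb eQ eST cQ by linarith
  ultimately have d1: "deg_in (S \<inter> T) z = 1" by simp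
  have eQ3: "esize Q + 3 = 2 * card Q" using d1 eQ eST cQ by linarith
  have "nbrs (S \<inter> T) z \<noteq> {}" using d1 by (auto simp: deg_in_def)
  then have wS: "w \<in> S \<inter> T" using nz nbrs_sub[of "S \<inter> T" z] by auto
  define M where "M = K \<inter> S"
  have wM: "w \<in> M" using wS wK by (auto simp: M_def)
  have QM: "Q = M \<union> U" using UQ by (auto simp: Q_def M_def K_def)
  have MU: "M \<inter> U = {}" by (auto simp: M_def K_def)
  have finM: "finite M" using finS by (auto simp: M_def)
  \<comment> \<open>If p had no neighbour in M, every edge inside Q would lie inside U or inside
    \<open>insert q M\<close>. As Q and U attain the bound, \<open>insert q M\<close> would exceed
    it by one.\<close>
  have key: "\<exists>m\<in>M. {p, m} \<in> E" if pq: "{p, q} = {x, y}" "p \<noteq> q" for p q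
  proof (rule ccontr)
    assume no: "\<not> ?thesis"
    have q: "q \<in> U" "q \<notin> M" using pq xyU MU by auto
    have "esize (insert q M \<union> U) + esize (insert q M \<inter> U) = esize (insert q M) + esize U"
    proof (rule esize_Un)
      fix v t assume vt: "v \<in> insert q M - U" "t \<in> U - insert q M"
      show "{v, t} \<notin> E"
      proof
        assume e: "{v, t} \<in> E"
        have "v \<in> M" using vt q by auto
        then have "t \<in> K \<union> {x, y, z}" using Knb e by (auto simp: M_def)
        then have "t = p" using vt pq U(3) by (auto simp: K_def)
        then show False using no e \<open>v \<in> M\<close> by (auto simp: insert_commute)
      qed
    qed
    moreover have "insert q M \<union> U = Q" "insert q M \<inter> U = {q}" using QM q MU by auto
    ultimately have "esize Q = esize (insert q M) + esize U" using esize_single by simp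
    moreover have "card Q = card M + card U" unfolding QM using finM finU MU by (rule card_Un_disjoint)
    moreover have "card (insert q M) = card M + 1" using finM q by simp
    moreover have "1 \<le> card M" using wM finM by (metis One_nat_def Suc_leI card_gt_0_iff empty_iff)
    moreover have "insert q M \<subset> V" using q UV SV zS MU U(3) by (auto simp: M_def K_def)
    ultimately show False using esize_bound[of "insert q M"] eQ3 eU by simp
  qed
  have more: "3 \<le> deg_in S p" if "{p, q} = {x, y}" "p \<noteq> q" "2 \<le> card (nbrs U p)"
    for p q
  proof -
    from key[OF that(1,2)] obtain m where m: "m \<in> M" "{p, m} \<in> E" by blast
    have "insert m (nbrs U p) \<subseteq> nbrs S p" using m US by (auto simp: nbrs_def M_def)
    moreover have "m \<notin> nbrs U p" using m MU by (auto simp: nbrs_def)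
    ultimately show ?thesis
      using that(3) card_mono[OF finite_nbrs'[OF finS, of p], of "insert m (nbrs U p)"]
        finite_nbrs'[OF finU, of p] by (simp add: deg_in_def)
  qed
  \<comment> \<open>Vertices of K have this degree by the choice of S; x and y have two neighbours
    in U and one in M; z loses only u of at least four neighbours; all other vertices have no
    neighbour in K and so lose none.\<close>
  have "3 \<le> deg_in S b" if b: "b \<in> S" for b
  proof -
    consider "b \<in> K" | "b = x" | "b = y" | "b = z" | "b \<notin> K \<union> {x, y, z}" by blast
    then show ?thesis
    proof cases
      case 1
      then show ?thesis using degK b by blast
    next
      case 2
      have "card U = card (U - {x, y}) + 2" using finU xyU xy(2) cU by (simp add: card_Diff_subset)
      then show ?thesis using more[of x y] xy(2) hub cU 2 by simp
    next
      case 3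
      then show ?thesis using more[of y x] xy by (auto simp: deg_in_def)
    next
      case 4
      have "nbrs V z \<subseteq> insert u (nbrs S z)"
      proof
        fix t assume t: "t \<in> nbrs V z"
        show "t \<in> insert u (nbrs S z)"
        proof (cases "t \<in> S")
          case False
          then have "t \<in> T" using un t by (auto simp: nbrs_def)
          then have "t \<in> nbrs T z" using t by (auto simp: nbrs_def)
          then show ?thesis using uw wS False by auto
        qed (use t in \<open>auto simp: nbrs_def\<close>)
      qed
      then have "card (nbrs V z) \<le> card (insert u (nbrs S z))"
        using finite_nbrs'[OF finS] by (intro card_mono) auto
      also have "\<dots> \<le> card (nbrs S z) + 1" by (simp add: card_insert_le_m1 card_insert_if finite_nbrs'[OF finS])
      finally show ?thesis using deg_B[of z] z(1) 4 by (simp add: deg_in_def)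
    next
      case 5
      have "nbrs V b \<subseteq> nbrs S b"
        using Knb[of _ b] 5 S(2) by (auto simp: nbrs_def insert_commute)
      then have "deg_in V b \<le> deg_in S b"
        unfolding deg_in_def using finite_nbrs'[OF finS] by (intro card_mono) auto
      then show ?thesis using min_deg[of b] b SV by auto
    qed
  qed
  then show False using no_core[OF SV] zS by fastforce
qed

section \<open>Wheels and pairs of glued copies\<close>

lemma wheel_case:
  assumes "card B \<le> 1"
  shows "\<exists>\<phi> n. wheel_embedding \<phi> n G"
proof -
  have V4: "4 \<le> card V"
  proof -
    obtain v where "v \<in> V" using card_V by fastforce
    then show ?thesis using min_deg[of v] deg_in_le[OF finite_V, of v] by auto
  qed
  \<comment> \<open>If \<open>B\<close> is empty, any vertex may serve as the hub.\<close>
  obtain x where x: "x \<in> V" "B \<subseteq> {x}"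
  proof (cases "B = {}")
    case True
    then show ?thesis using that V4 by fastforce
  next
    case False
    then obtain x where "B = {x}" using assms finite_B
      by (metis One_nat_def card_0_eq card_1_singletonE le_Suc_eq le_zero_eq)
    then show ?thesis using that B_sub by auto
  qed
  have A3: "deg_in V v = 3" if "v \<in> V - {x}" for v using deg_A that x(2) by auto
  \<comment> \<open>The degree sum 4|V| - 4, less 3 for each vertex other than x, leaves |V| - 1 for
    x.\<close>
  have "(\<Sum>v\<in>V. deg_in V v) = deg_in V x + (\<Sum>v\<in>V - {x}. deg_in V v)"
    using finite_V x(1) by (rule sum.remove)
  also have "(\<Sum>v\<in>V - {x}. deg_in V v) = (\<Sum>v\<in>V - {x}. 3)" using A3 by (intro sum.cong) auto
  finally have "deg_in V x + 1 = card V" using degree_sum_V finite_V x(1) V4 by simp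
  then have "card (nbrs V x) = card (V - {x})" using finite_V x(1) by (simp add: deg_in_def)
  then have hub: "nbrs V x = V - {x}"
    using nbrs_sub[of V x] finite_V by (intro card_subset_eq) auto
  have h: "{x, v} \<in> E" if "v \<in> V - {x}" for v
    using that unfolding hub[symmetric] by (simp add: nbrs_def)
  have "V - {x} \<noteq> {}"
  proof
    assume "V - {x} = {}"
    then have "V \<subseteq> {x}" by blast
    then show False using card_mono[of "{x}" V] V4 by simp
  qed
  \<comment> \<open>Any vertex y of the rim can play the role of \<open>ConnY\<close>: it has two
    neighbours besides x, and the edge to x is the one that a wheel has in addition to
    \<open>H_graph\<close>.\<close>
  then obtain y where y: "y \<in> V" "y \<noteq> x" by blast
  have "nbrs (V - {x}) y = nbrs V y - {x}" by (auto simp: nbrs_def)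
  moreover have "x \<in> nbrs V y" using h[of y] x y by (auto simp: nbrs_def insert_commute)
  ultimately have dy: "deg_in (V - {x}) y = 2" using A3[of y] y by (simp add: deg_in_def)
  have h': "{x, v} \<in> E" if "v \<in> V - {x, y}" for v using h that by blast
  have d3: "deg_in V v = 3" if "v \<in> V - {x, y}" for v using A3 that by blast
  have sp: "\<exists>v\<in>D. deg_in D v \<le> 1" if "D \<subseteq> V - {x, y}" "D \<noteq> {}" for D
    using hub_sparse[of x y D] x y h that by blast
  obtain \<phi> n where \<phi>: "4 \<le> n" "inj_on \<phi> (verts (H_graph n))" "\<phi> ConnX = x" "\<phi> ConnY = y"
    "\<phi> ` verts (H_graph n) = V" "edges_in V - {{x, y}} = (`) \<phi> ` edges (H_graph n)"
    using H_graph_structure[OF order_refl x(1) y(1) not_sym[OF y(2)] h' d3 dy sp] .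
  moreover have "E = insert {x, y} (E - {{x, y}})" using h[of y] y by blast
  ultimately have "wheel_embedding \<phi> n G" by (simp add: wheel_embedding_def edges_in_V)
  then show ?thesis by blast
qed

text \<open>Let T consist of \<open>B\<close> and all vertices outside S. Closedness of S leaves no
  edge between S - B and V - S, and \<open>B\<close> spans no edge, so T spans |E| - (2|S| - 3) =
  2|T| - 3 edges. Thus T is tight, and by the same separation closed, so that S and T are both
  copies of \<open>H_graph\<close> with connector set \<open>B\<close>.\<close>

lemma glue_case:
  assumes "card B = 2"
  shows "\<exists>\<phi> \<psi> i j. glued \<phi> \<psi> i j G"
proof -
  obtain S where S: "tight S" "closed S" "card (S \<inter> B) = 2"
    using exists_closed[of 2] assms by auto
  have SB: "S \<inter> B = B" using S(3) assms finite_B by (intro card_subset_eq) auto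
  have SV: "S \<subset> V" and eS: "esize S + 3 = 2 * card S" using S(1) by (auto simp: tight_def)
  have finS: "finite S" using SV finite_sub by blast
  have "3 \<le> card S" using tight_card S by simp
  define T where "T = (V - S) \<union> B"
  have un: "S \<union> T = V" and int: "S \<inter> T = B" using SB SV B_sub by (auto simp: T_def)
  have sep: "{v, w} \<notin> E" if "v \<in> S - T" "w \<in> T - S" for v w
    using closed_nbrs[of S v w] S SV that by (auto simp: T_def)
  \<comment> \<open>T = V would mean S = B, but S has at least three vertices and \<open>B\<close>
    only two.\<close>
  have TV: "T \<subset> V"
  proof -
    have "T \<noteq> V"
    proof
      assume "T = V"
      then have "S = B" using int SV by auto
      then show False using \<open>3 \<le> card S\<close> assms by simp
    qed
    then show ?thesis using un by blast
  qed
  have finT: "finite T" using TV finite_sub by blast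
  have cT: "card V + 2 = card S + card T" using card_Un_Int[OF finS finT] un int assms by simp
  have "esize B = 0"
  proof -
    have "\<not> e \<subseteq> B" if "e \<in> E" for e
    proof -
      from that obtain v w where "e = {v, w}" by (meson edge_exE)
      then show ?thesis using B_indep[of v w] that by auto
    qed
    then have "edges_in B = {}" by (auto simp: edges_in_def)
    then show ?thesis by (simp add: esize_def)
  qed
  moreover have "esize (S \<union> T) + esize (S \<inter> T) = esize S + esize T"
    by (rule esize_Un) (rule sep)
  ultimately have "card E = esize S + esize T" using un int esize_V by simp
  moreover have "card B \<le> card T" using finT by (intro card_mono) (auto simp: T_def)
  ultimately have tT: "tight T" using TV eS cT card_E card_V assms by (auto simp: tight_def)
  have cloT: "closed T"
    unfolding closed_def
  proof
    fix v assume v: "v \<in> T - B"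
    have "nbrs V v \<subseteq> nbrs T v"
    proof
      fix w assume w: "w \<in> nbrs V v"
      have "w \<in> T"
      proof (rule ccontr)
        assume "w \<notin> T"
        moreover then have "w \<in> S" using w un by (auto simp: nbrs_def)
        moreover have "v \<in> T - S" using v int by blast
        ultimately show False using sep[of w v] w by (auto simp: nbrs_def insert_commute)
      qed
      then show "w \<in> nbrs T v" using w by (auto simp: nbrs_def)
    qed
    then have "deg_in V v \<le> deg_in T v"
      unfolding deg_in_def using finite_nbrs'[OF finT] by (intro card_mono) auto
    then show "3 \<le> deg_in T v" using min_deg[of v] v TV by auto
  qed
  have TB: "T \<inter> B = B" by (auto simp: T_def)
  then have cTB: "card (T \<inter> B) = 2" using assms by simp
  obtain \<phi> i where \<phi>: "4 \<le> i" "inj_on \<phi> (verts (H_graph i))" "\<phi> ` {ConnX, ConnY} = S \<inter> B"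
    "\<phi> ` verts (H_graph i) = S" "edges_in S = (`) \<phi> ` edges (H_graph i)"
    using closed_tight_H_graph[OF S] .
  obtain \<psi> j where \<psi>: "4 \<le> j" "inj_on \<psi> (verts (H_graph j))" "\<psi> ` {ConnX, ConnY} = T \<inter> B"
    "\<psi> ` verts (H_graph j) = T" "edges_in T = (`) \<psi> ` edges (H_graph j)"
    using closed_tight_H_graph[OF tT cloT cTB] .
  have "edges_in (S \<union> T) = edges_in S \<union> edges_in T" by (rule edges_in_Un) (rule sep)
  then have "E = edges_in S \<union> edges_in T" using un edges_in_V by simp
  then have "glued \<phi> \<psi> i j G" using \<phi> \<psi> SB TB un int by (simp add: glued_def)
  then show ?thesis by blast
qed

end

theorem theorem4p1:
  fixes G :: "'a graph"
  assumes "simple_graph G"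
  shows "G \<in> extremal_family \<longleftrightarrow>
    (\<exists>n\<ge>4. isomorphic G (wheel n)) \<or>
    (\<exists>i\<ge>4. \<exists>j\<ge>4. isomorphic G (glue_straight i j) \<or> isomorphic G (glue_crossed i j))"
proof -
  have "(\<exists>\<phi> n. wheel_embedding \<phi> n G) \<or> (\<exists>\<phi> \<psi> i j. glued \<phi> \<psi> i j G)"
    if "G \<in> extremal_family"
  proof -
    interpret critical G using assms that by unfold_locales
    consider "card B \<le> 1" | "card B = 2" using card_B_le by linarith
    then show ?thesis
    proof cases
      case 1
      then show ?thesis using wheel_case by blast
    next
      case 2
      then show ?thesis using glue_case by blast
    qed
  qed
  moreover have "G \<in> extremal_family" if "wheel_embedding \<phi> n G" for \<phi> n
    using assms that by (rule wheel_extremal)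
  moreover have "G \<in> extremal_family" if "glued \<phi> \<psi> i j G" for \<phi> \<psi> i j
    using assms that by (rule glued_extremal)
  ultimately show ?thesis
    unfolding isomorphic_wheel_iff[OF assms] isomorphic_glue_family_iff[OF assms] by blast
qed

end
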